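(* Let $K$ be a number field, $m\ge1$, and let $X\subseteq(\mathbb{A}_K^{fin})^m$ be definable in the language of rings. Let $L$ be any language extending the ring language in which the completions $K_v$, $v\in V_K^f$, admit uniform quantifier elimination in a sort $\sigma$ relative to the other sorts. Then $X$ is a finite Boolean combination of sets of the following two types: (Type I) $\{\bar x\in(\mathbb{A}_K^{fin})^m: C_j([[\varphi(\bar x)]])\}$ with $j\ge1$; (Type II) $\{\bar x\in(\mathbb{A}_K^{fin})^m: \mathrm{Fin}([[\psi(\bar x)]])\}$; where $\varphi(\bar x),\psi(\bar x)$ are $L$-formulas that are quantifier-free in the sort $\sigma$. If $L$ is one-sorted, $\varphi$ and $\psi$ can be chosen quantifier-free in $L$.
   Context: $V_K^f$ denotes the non-archimedean places of $K$, $K_v$ the completions, and $\mathbb{A}_K^{fin}$ the restricted direct product of the $K_v$ with respect to their valuation rings, with componentwise operations. For a formula $\Phi(\bar x)$ and $\bar a\in(\mathbb{A}_K^{fin})^m$, $[[\Phi(\bar a)]]=\{v\in V_K^f: K_v\models\Phi(\bar a(v))\}$. $C_j(Y)$ means $Y$ has at least $j$ elements, and $\mathrm{Fin}(Y)$ means $Y$ is finite. Uniform quantifier elimination in sort $\sigma$ relative to other sorts means every $L$-formula is equivalent in all $K_v$ ($v\in V_K^f$) simultaneously to one without quantifiers over variables of sort $\sigma$. *)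

theory Defs
  imports Complex_Main "HOL-Library.FuncSet" "HOL-Algebra.QuotRing"
begin

section \<open>Many-sorted first-order logic\<close>

text \<open>A signature uses only the sorts and symbols in the three sets; the types
  \<open>'s\<close>, \<open>'f\<close>, \<open>'r\<close> merely provide names. Constants are function symbols without arguments.\<close>

record ('s, 'f, 'r) fo_signature =
  sorts :: "'s set"
  funs :: "'f set"
  rels :: "'r set"
  fun_args :: "'f \<Rightarrow> 's list"
  fun_sort :: "'f \<Rightarrow> 's"
  rel_args :: "'r \<Rightarrow> 's list"

definition wf_signature :: "('s, 'f, 'r) fo_signature \<Rightarrow> bool" where
  "wf_signature L \<longleftrightarrow>
     (\<forall>f\<in>funs L. set (fun_args L f) \<subseteq> sorts L \<and> fun_sort L f \<in> sorts L) \<and>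
     (\<forall>r\<in>rels L. set (rel_args L r) \<subseteq> sorts L)"

text \<open>\<open>Var (s, i)\<close> is the \<open>i\<close>-th variable of sort \<open>s\<close>.\<close>

datatype ('s, 'f) fo_term = Var "'s \<times> nat" | App 'f "('s, 'f) fo_term list"

datatype ('s, 'f, 'r) fo_form =
    Eq "('s, 'f) fo_term" "('s, 'f) fo_term"
  | Rel 'r "('s, 'f) fo_term list"
  | Neg "('s, 'f, 'r) fo_form"
  | Conj "('s, 'f, 'r) fo_form" "('s, 'f, 'r) fo_form"
  | Exists "'s \<times> nat" "('s, 'f, 'r) fo_form"

inductive has_sort :: "('s, 'f, 'r) fo_signature \<Rightarrow> ('s, 'f) fo_term \<Rightarrow> 's \<Rightarrow> bool"
  for L :: "('s, 'f, 'r) fo_signature" where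
  "s \<in> sorts L \<Longrightarrow> has_sort L (Var (s, i)) s"
| "f \<in> funs L \<Longrightarrow> list_all2 (has_sort L) ts (fun_args L f) \<Longrightarrow>
     has_sort L (App f ts) (fun_sort L f)"

primrec formula :: "('s, 'f, 'r) fo_signature \<Rightarrow> ('s, 'f, 'r) fo_form \<Rightarrow> bool" where
  "formula L (Eq t u) \<longleftrightarrow> (\<exists>s. has_sort L t s \<and> has_sort L u s)"
| "formula L (Rel r ts) \<longleftrightarrow> r \<in> rels L \<and> list_all2 (has_sort L) ts (rel_args L r)"
| "formula L (Neg \<phi>) \<longleftrightarrow> formula L \<phi>"
| "formula L (Conj \<phi> \<psi>) \<longleftrightarrow> formula L \<phi> \<and> formula L \<psi>"
| "formula L (Exists x \<phi>) \<longleftrightarrow> fst x \<in> sorts L \<and> formula L \<phi>"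

primrec term_vars :: "('s, 'f) fo_term \<Rightarrow> ('s \<times> nat) set" where
  "term_vars (Var x) = {x}"
| "term_vars (App f ts) = \<Union> (set (map term_vars ts))"

primrec free_vars :: "('s, 'f, 'r) fo_form \<Rightarrow> ('s \<times> nat) set" where
  "free_vars (Eq t u) = term_vars t \<union> term_vars u"
| "free_vars (Rel r ts) = \<Union> (term_vars ` set ts)"
| "free_vars (Neg \<phi>) = free_vars \<phi>"
| "free_vars (Conj \<phi> \<psi>) = free_vars \<phi> \<union> free_vars \<psi>"
| "free_vars (Exists x \<phi>) = free_vars \<phi> - {x}"

primrec quantified_sorts :: "('s, 'f, 'r) fo_form \<Rightarrow> 's set" where
  "quantified_sorts (Eq t u) = {}"
| "quantified_sorts (Rel r ts) = {}"
| "quantified_sorts (Neg \<phi>) = quantified_sorts \<phi>"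
| "quantified_sorts (Conj \<phi> \<psi>) = quantified_sorts \<phi> \<union> quantified_sorts \<psi>"
| "quantified_sorts (Exists x \<phi>) = insert (fst x) (quantified_sorts \<phi>)"

definition quantifier_free_in :: "'s \<Rightarrow> ('s, 'f, 'r) fo_form \<Rightarrow> bool" where
  "quantifier_free_in s \<phi> \<longleftrightarrow> s \<notin> quantified_sorts \<phi>"

definition quantifier_free :: "('s, 'f, 'r) fo_form \<Rightarrow> bool" where
  "quantifier_free \<phi> \<longleftrightarrow> quantified_sorts \<phi> = {}"

record ('s, 'f, 'r, 'u) fo_structure =
  univ :: "'s \<Rightarrow> 'u set"
  fun_int :: "'f \<Rightarrow> 'u list \<Rightarrow> 'u"
  rel_int :: "'r \<Rightarrow> 'u list \<Rightarrow> bool"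

definition is_structure ::
  "('s, 'f, 'r) fo_signature \<Rightarrow> ('s, 'f, 'r, 'u) fo_structure \<Rightarrow> bool" where
  "is_structure L M \<longleftrightarrow>
     (\<forall>s\<in>sorts L. univ M s \<noteq> {}) \<and>
     (\<forall>f\<in>funs L. \<forall>as. list_all2 (\<lambda>a s. a \<in> univ M s) as (fun_args L f) \<longrightarrow>
        fun_int M f as \<in> univ M (fun_sort L f))"

primrec eval_term ::
  "('s, 'f, 'r, 'u) fo_structure \<Rightarrow> ('s \<times> nat \<Rightarrow> 'u) \<Rightarrow> ('s, 'f) fo_term \<Rightarrow> 'u" where
  "eval_term M \<alpha> (Var x) = \<alpha> x"
| "eval_term M \<alpha> (App f ts) = fun_int M f (map (eval_term M \<alpha>) ts)"

primrec sat ::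
  "('s, 'f, 'r, 'u) fo_structure \<Rightarrow> ('s \<times> nat \<Rightarrow> 'u) \<Rightarrow> ('s, 'f, 'r) fo_form \<Rightarrow> bool" where
  "sat M \<alpha> (Eq t u) \<longleftrightarrow> eval_term M \<alpha> t = eval_term M \<alpha> u"
| "sat M \<alpha> (Rel r ts) \<longleftrightarrow> rel_int M r (map (eval_term M \<alpha>) ts)"
| "sat M \<alpha> (Neg \<phi>) \<longleftrightarrow> \<not> sat M \<alpha> \<phi>"
| "sat M \<alpha> (Conj \<phi> \<psi>) \<longleftrightarrow> sat M \<alpha> \<phi> \<and> sat M \<alpha> \<psi>"
| "sat M \<alpha> (Exists x \<phi>) \<longleftrightarrow> (\<exists>a\<in>univ M (fst x). sat M (\<alpha>(x := a)) \<phi>)"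

definition uniform_qe ::
  "('s, 'f, 'r) fo_signature \<Rightarrow> 's \<Rightarrow> 'i set \<Rightarrow> ('i \<Rightarrow> ('s, 'f, 'r, 'u) fo_structure) \<Rightarrow> bool" where
  "uniform_qe L \<sigma> I M \<longleftrightarrow>
     (\<forall>\<phi>. formula L \<phi> \<longrightarrow>
       (\<exists>\<psi>. formula L \<psi> \<and> free_vars \<psi> \<subseteq> free_vars \<phi> \<and> quantifier_free_in \<sigma> \<psi> \<and>
         (\<forall>i\<in>I. \<forall>\<alpha>. (\<forall>x\<in>free_vars \<phi>. \<alpha> x \<in> univ (M i) (fst x)) \<longrightarrow>
            (sat (M i) \<alpha> \<phi> \<longleftrightarrow> sat (M i) \<alpha> \<psi>))))"


section \<open>The language of rings\<close>

datatype ring_symbol = RZero | ROne | RAdd | RNeg | RMult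

primrec ring_arity :: "ring_symbol \<Rightarrow> nat" where
  "ring_arity RZero = 0"
| "ring_arity ROne = 0"
| "ring_arity RAdd = 2"
| "ring_arity RNeg = 1"
| "ring_arity RMult = 2"

definition ring_language :: "(unit, ring_symbol, unit) fo_signature" where
  "ring_language =
     \<lparr>sorts = {()}, funs = UNIV, rels = {},
      fun_args = (\<lambda>f. replicate (ring_arity f) ()), fun_sort = (\<lambda>_. ()), rel_args = (\<lambda>_. [])\<rparr>"

primrec ring_int :: "'a ring \<Rightarrow> ring_symbol \<Rightarrow> 'a list \<Rightarrow> 'a" where
  "ring_int R RZero as = \<zero>\<^bsub>R\<^esub>"
| "ring_int R ROne as = \<one>\<^bsub>R\<^esub>"
| "ring_int R RAdd as = as ! 0 \<oplus>\<^bsub>R\<^esub> as ! 1"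
| "ring_int R RNeg as = \<ominus>\<^bsub>R\<^esub> (as ! 0)"
| "ring_int R RMult as = as ! 0 \<otimes>\<^bsub>R\<^esub> as ! 1"

definition ring_structure :: "'a ring \<Rightarrow> (unit, ring_symbol, unit, 'a) fo_structure" where
  "ring_structure R =
     \<lparr>univ = (\<lambda>_. carrier R), fun_int = ring_int R, rel_int = (\<lambda>_ _. False)\<rparr>"

definition tuples :: "'a ring \<Rightarrow> nat \<Rightarrow> (nat \<Rightarrow> 'a) set" where
  "tuples R m = {..<m} \<rightarrow>\<^sub>E carrier R"

definition ring_definable :: "'a ring \<Rightarrow> nat \<Rightarrow> (nat \<Rightarrow> 'a) set \<Rightarrow> bool" where
  "ring_definable R m X \<longleftrightarrow>
     (\<exists>\<Phi>. formula ring_language \<Phi> \<and> free_vars \<Phi> \<subseteq> {()} \<times> {..<m} \<and>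
          X = {x \<in> tuples R m. sat (ring_structure R) (\<lambda>(_, i). x i) \<Phi>})"

text \<open>The ring symbols occur in \<open>L\<close> under the names given by \<open>\<iota>\<close>, as operations on sort \<open>h\<close>.\<close>

definition extends_ring_language ::
  "('s, 'f, 'r) fo_signature \<Rightarrow> 's \<Rightarrow> (ring_symbol \<Rightarrow> 'f) \<Rightarrow> bool" where
  "extends_ring_language L h \<iota> \<longleftrightarrow>
     wf_signature L \<and> h \<in> sorts L \<and> inj \<iota> \<and>
     (\<forall>f. \<iota> f \<in> funs L \<and> fun_args L (\<iota> f) = replicate (ring_arity f) h \<and> fun_sort L (\<iota> f) = h)"

text \<open>\<open>M\<close> is an \<open>L\<close>-structure whose sort \<open>h\<close> is the ring \<open>R\<close>. The left summand of the universe
  holds \<open>R\<close> itself; the right summand leaves room for the elements of the other sorts.\<close>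

definition expands_ring ::
  "('s, 'f, 'r) fo_signature \<Rightarrow> 's \<Rightarrow> (ring_symbol \<Rightarrow> 'f) \<Rightarrow> 'a ring \<Rightarrow>
   ('s, 'f, 'r, 'a + 'b) fo_structure \<Rightarrow> bool" where
  "expands_ring L h \<iota> R M \<longleftrightarrow>
     is_structure L M \<and> univ M h = Inl ` carrier R \<and>
     (\<forall>f as. set as \<subseteq> carrier R \<and> length as = ring_arity f \<longrightarrow>
        fun_int M (\<iota> f) (map Inl as) = Inl (ring_int R f as))"


section \<open>Non-archimedean places and completions\<close>

definition number_field :: "'k::field_char_0 itself \<Rightarrow> bool" where
  "number_field _ \<longleftrightarrow>
     (\<exists>B. finite_dimensional_vector_space (\<lambda>(q::rat) (x::'k). of_rat q * x) B)"

definition absolute_value :: "('k::field \<Rightarrow> real) \<Rightarrow> bool" where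
  "absolute_value a \<longleftrightarrow>
     (\<forall>x. 0 \<le> a x) \<and> (\<forall>x. a x = 0 \<longleftrightarrow> x = 0) \<and>
     (\<forall>x y. a (x * y) = a x * a y) \<and> (\<forall>x y. a (x + y) \<le> a x + a y)"

definition nonarch_absolute_values :: "('k::field \<Rightarrow> real) set" where
  "nonarch_absolute_values =
     {a. absolute_value a \<and> (\<forall>x y. a (x + y) \<le> max (a x) (a y)) \<and> (\<exists>x. x \<noteq> 0 \<and> a x \<noteq> 1)}"

definition equivalent_absolute_values :: "(('k::field \<Rightarrow> real) \<times> ('k \<Rightarrow> real)) set" where
  "equivalent_absolute_values = {(a, b). \<exists>s>0. \<forall>x. b x = a x powr s}"

type_synonym 'k place = "('k \<Rightarrow> real) set"

definition finite_places :: "'k::field place set" where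
  "finite_places = nonarch_absolute_values //
     (equivalent_absolute_values \<inter> nonarch_absolute_values \<times> nonarch_absolute_values)"

definition place_abs :: "'k place \<Rightarrow> 'k \<Rightarrow> real" where
  "place_abs v = (SOME a. a \<in> v)"

definition cauchy_ring :: "('k::field \<Rightarrow> real) \<Rightarrow> (nat \<Rightarrow> 'k) ring" where
  "cauchy_ring a =
     \<lparr>carrier = {f. \<forall>e>0. \<exists>N. \<forall>m\<ge>N. \<forall>n\<ge>N. a (f m - f n) < e},
      mult = (\<lambda>f g n. f n * g n), one = (\<lambda>_. 1),
      zero = (\<lambda>_. 0), add = (\<lambda>f g n. f n + g n)\<rparr>"

definition null_sequences :: "('k::field \<Rightarrow> real) \<Rightarrow> (nat \<Rightarrow> 'k) set" where
  "null_sequences a = {f. (\<lambda>n. a (f n)) \<longlonglongrightarrow> 0}"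

text \<open>Cauchy sequences and null sequences do not depend on the representative of the place.\<close>

type_synonym 'k completed = "(nat \<Rightarrow> 'k) set"

definition completion :: "'k::field place \<Rightarrow> 'k completed ring" where
  "completion v = cauchy_ring (place_abs v) Quot null_sequences (place_abs v)"

definition completion_abs :: "'k::field place \<Rightarrow> 'k completed \<Rightarrow> real" where
  "completion_abs v c = (THE r. \<forall>f\<in>c. (\<lambda>n. place_abs v (f n)) \<longlonglongrightarrow> r)"

definition valuation_ring :: "'k::field place \<Rightarrow> 'k completed set" where
  "valuation_ring v = {c \<in> carrier (completion v). completion_abs v c \<le> 1}"


section \<open>Finite adeles\<close>

definition restricted_product :: "'i set \<Rightarrow> ('i \<Rightarrow> 'a ring) \<Rightarrow> ('i \<Rightarrow> 'a set) \<Rightarrow> ('i \<Rightarrow> 'a) ring" where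
  "restricted_product I R B =
     \<lparr>carrier = {x \<in> Pi\<^sub>E I (\<lambda>i. carrier (R i)). finite {i\<in>I. x i \<notin> B i}},
      mult = (\<lambda>x y. \<lambda>i\<in>I. x i \<otimes>\<^bsub>R i\<^esub> y i), one = (\<lambda>i\<in>I. \<one>\<^bsub>R i\<^esub>),
      zero = (\<lambda>i\<in>I. \<zero>\<^bsub>R i\<^esub>), add = (\<lambda>x y. \<lambda>i\<in>I. x i \<oplus>\<^bsub>R i\<^esub> y i)\<rparr>"

definition finite_adeles :: "('k::field place \<Rightarrow> 'k completed) ring" where
  "finite_adeles = restricted_product finite_places completion valuation_ring"


section \<open>Sets of type I and II\<close>

text \<open>The set \<open>[[\<phi>(x)]]\<close> of indices at which \<open>\<phi>\<close> holds, where the \<open>i\<close>-th variable of sort \<open>h\<close>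
  is interpreted by the \<open>i\<close>-th entry of the tuple \<open>x\<close>. It is only used for formulas whose
  free variables have sort \<open>h\<close>, so the assignment may ignore the sort of a variable.\<close>

definition boolean_value ::
  "'i set \<Rightarrow> ('i \<Rightarrow> ('s, 'f, 'r, 'a + 'b) fo_structure) \<Rightarrow> ('s, 'f, 'r) fo_form \<Rightarrow>
   (nat \<Rightarrow> 'i \<Rightarrow> 'a) \<Rightarrow> 'i set" where
  "boolean_value I M \<phi> x = {v\<in>I. sat (M v) (\<lambda>(_, i). Inl (x i v)) \<phi>}"

definition at_least :: "nat \<Rightarrow> 'a set \<Rightarrow> bool" where
  "at_least j Y \<longleftrightarrow> (\<exists>F\<subseteq>Y. finite F \<and> card F = j)"

text \<open>\<open>Q\<close> selects the formulas that are admitted.\<close>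

definition type_I_sets ::
  "('s, 'f, 'r) fo_signature \<Rightarrow> 's \<Rightarrow>
   ('k::field place \<Rightarrow> ('s, 'f, 'r, 'k completed + 'b) fo_structure) \<Rightarrow>
   nat \<Rightarrow> (('s, 'f, 'r) fo_form \<Rightarrow> bool) \<Rightarrow> (nat \<Rightarrow> 'k place \<Rightarrow> 'k completed) set set" where
  "type_I_sets L h M m Q =
     {{x \<in> tuples finite_adeles m. at_least j (boolean_value finite_places M \<phi> x)} | j \<phi>.
        1 \<le> j \<and> formula L \<phi> \<and> free_vars \<phi> \<subseteq> {h} \<times> {..<m} \<and> Q \<phi>}"

definition type_II_sets ::
  "('s, 'f, 'r) fo_signature \<Rightarrow> 's \<Rightarrow>
   ('k::field place \<Rightarrow> ('s, 'f, 'r, 'k completed + 'b) fo_structure) \<Rightarrow>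
   nat \<Rightarrow> (('s, 'f, 'r) fo_form \<Rightarrow> bool) \<Rightarrow> (nat \<Rightarrow> 'k place \<Rightarrow> 'k completed) set set" where
  "type_II_sets L h M m Q =
     {{x \<in> tuples finite_adeles m. finite (boolean_value finite_places M \<psi> x)} | \<psi>.
        formula L \<psi> \<and> free_vars \<psi> \<subseteq> {h} \<times> {..<m} \<and> Q \<psi>}"

inductive_set boolean_combinations :: "'a set \<Rightarrow> 'a set set \<Rightarrow> 'a set set"
  for \<Omega> :: "'a set" and \<G> :: "'a set set" where
  "A \<in> \<G> \<Longrightarrow> A \<in> boolean_combinations \<Omega> \<G>"
| "A \<in> boolean_combinations \<Omega> \<G> \<Longrightarrow> \<Omega> - A \<in> boolean_combinations \<Omega> \<G>"
| "A \<in> boolean_combinations \<Omega> \<G> \<Longrightarrow> B \<in> boolean_combinations \<Omega> \<G> \<Longrightarrow>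
     A \<union> B \<in> boolean_combinations \<Omega> \<G>"

end

theory Submission
  imports Defs "HOL-Library.Infinite_Set"
begin

text \<open>
  The first ingredient is a parameter-free ring formula that defines the valuation ring \<open>O\<^sub>v\<close> in every
  \<open>K\<^sub>v\<close>. For a parameter \<open>b\<close> put \<open>S\<^sub>b = {x. \<exists>y. y\<^sup>2 + y = b x\<^sup>2}\<close>. If \<open>b\<close> is a uniformizer then
  \<open>S\<^sub>b = O\<^sub>v\<close>: for \<open>|x| \<le> 1\<close> the equation is solved by Newton iteration, and for \<open>|x| > 1\<close> it would
  give \<open>|b|\<close> a square root in the value group. Conversely, if \<open>S\<^sub>b\<close> is any valuation subring, then it
  contains \<open>O\<^sub>v\<close>: it contains a neighbourhood of 0, hence (being integrally closed) the maximal ideal,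
  hence every \<open>x \<in> O\<^sub>v \<inter> K\<close>, since \<open>x\<close> satisfies a monic integral equation modulo the maximal
  ideal. So \<open>O\<^sub>v\<close> is the intersection of the valuation subrings of the form \<open>S\<^sub>b\<close>.

  The second ingredient is the method of Feferman and Vaught. By induction on a ring formula, its truth
  in the restricted product depends only on the sizes, cut off at some finite bound but with infinity
  remembered, of the sets of places at which a given truth pattern of finitely many local formulas is
  realised. In the quantifier step the witness is transported by a back-and-forth argument, and the
  formula defining \<open>O\<^sub>v\<close> is added to the local formulas so that the new witness is again integral at
  almost all places. Uniform quantifier elimination is then applied to each local formula.
\<close>

section \<open>Nonarchimedean absolute values\<close>

locale nonarch_field =
  fixes a :: "'k::field \<Rightarrow> real"
  assumes nonarch: "a \<in> nonarch_absolute_values"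
begin

lemma a_nonneg [simp]: "0 \<le> a x"
  and a_eq_0_iff [simp]: "a x = 0 \<longleftrightarrow> x = 0"
  and a_mult: "a (x * y) = a x * a y"
  and a_ultra: "a (x + y) \<le> max (a x) (a y)"
  and a_nontrivial: "\<exists>x. x \<noteq> 0 \<and> a x \<noteq> 1"
  using nonarch by (auto simp: nonarch_absolute_values_def absolute_value_def)

lemma a_zero [simp]: "a 0 = 0"
  by simp

lemma a_pos_iff [simp]: "0 < a x \<longleftrightarrow> x \<noteq> 0"
  using a_nonneg[of x] a_eq_0_iff[of x] by linarith

lemma a_one [simp]: "a 1 = 1"
  using a_mult[of 1 1] a_eq_0_iff[of 1] by simp

lemma a_minus [simp]: "a (- x) = a x"
proof -
  have "a (-1) * a (-1) = 1"
    using a_mult[of "-1" "-1"] by simp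
  then have "a (-1) = 1"
    using a_nonneg[of "-1"] by (simp add: square_eq_1_iff)
  then show ?thesis
    using a_mult[of "-1" x] by simp
qed

lemma a_diff_commute: "a (x - y) = a (y - x)"
  using a_minus[of "x - y"] by simp

lemma a_diff: "a (x - y) \<le> max (a x) (a y)"
  using a_ultra[of x "- y"] by simp

lemma a_power: "a (x ^ n) = a x ^ n"
  by (induction n) (simp_all add: a_mult)

lemma a_inverse: "a (inverse x) = inverse (a x)"
proof (cases "x = 0")
  case False
  then have "a x * a (inverse x) = 1"
    using a_mult[of x "inverse x"] by simp
  then show ?thesis
    by (simp add: inverse_unique)
qed simp

lemma a_divide: "a (x / y) = a x / a y"
  by (simp add: divide_inverse a_mult a_inverse)

text \<open>Write \<open>y\<close> as \<open>(x + y) - x\<close>: in the ultrametric inequality the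
  bound \<open>a x\<close> is excluded by the assumption, so \<open>a (x + y)\<close> cannot drop
  below \<open>a y\<close>.\<close>

lemma a_add_eq: assumes "a x < a y" shows "a (x + y) = a y"
proof -
  have "a y \<le> max (a (x + y)) (a x)"
    using a_diff[of "x + y" x] by simp
  then show ?thesis
    using a_ultra[of x y] assms by linarith
qed

lemma a_abs_diff: "\<bar>a x - a y\<bar> \<le> a (x - y)"
proof -
  have "a x \<le> max (a (x - y)) (a y)" "a y \<le> max (a (x - y)) (a x)"
    using a_ultra[of "x - y" y] a_diff[of x "x - y"] by simp_all
  then show ?thesis
    using a_nonneg[of x] a_nonneg[of y] a_nonneg[of "x - y"] by linarith
qed

lemma a_sum_less:
  assumes "finite A" "0 < r" "\<And>i. i \<in> A \<Longrightarrow> a (f i) < r"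
  shows "a (sum f A) < r"
  using assms
proof (induction A rule: finite_induct)
  case (insert i A)
  then show ?case
    using a_ultra[of "f i" "sum f A"] by fastforce
qed simp

lemma a_of_nat_le_1: "a (of_nat n) \<le> 1"
proof (induction n)
  case (Suc n)
  then show ?case
    using a_ultra[of 1 "of_nat n"] by simp
qed simp

lemma a_of_int_le_1: "a (of_int n) \<le> 1"
  by (cases n rule: int_cases2) (simp_all add: a_of_nat_le_1)

lemma a_mult_less_1: "a x < 1 \<Longrightarrow> a y \<le> 1 \<Longrightarrow> a (x * y) < 1"
  using mult_right_le_one_le[of "a x" "a y"] by (simp add: a_mult)

section \<open>Cauchy sequences and null sequences\<close>

abbreviation C where "C \<equiv> carrier (cauchy_ring a)"
abbreviation Z where "Z \<equiv> null_sequences a"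

lemma C_iff: "f \<in> C \<longleftrightarrow> (\<forall>e>0. \<exists>N. \<forall>m\<ge>N. \<forall>n\<ge>N. a (f m - f n) < e)"
  by (simp add: cauchy_ring_def)

lemma C_D: "f \<in> C \<Longrightarrow> 0 < e \<Longrightarrow> \<exists>N. \<forall>m\<ge>N. \<forall>n\<ge>N. a (f m - f n) < e"
  by (simp add: C_iff)

lemma Z_iff: "f \<in> Z \<longleftrightarrow> (\<forall>e>0. \<forall>\<^sub>F n in sequentially. a (f n) < e)"
  by (simp add: null_sequences_def tendsto_iff)

lemma Z_D: "f \<in> Z \<Longrightarrow> 0 < e \<Longrightarrow> \<forall>\<^sub>F n in sequentially. a (f n) < e"
  by (simp add: Z_iff)

lemma C_const [simp]: "(\<lambda>_. c) \<in> C"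
  by (simp add: C_iff)

lemma C_minus: "f \<in> C \<Longrightarrow> (\<lambda>n. - f n) \<in> C"
  by (simp add: C_iff a_diff_commute[of "- f _" for f])
     (metis a_diff_commute minus_diff_eq uminus_add_conv_diff)

lemma C_add:
  assumes "f \<in> C" "g \<in> C"
  shows "(\<lambda>n. f n + g n) \<in> C"
  unfolding C_iff
proof (intro allI impI)
  fix e :: real assume "0 < e"
  then obtain N M where NM: "\<And>m n. N \<le> m \<Longrightarrow> N \<le> n \<Longrightarrow> a (f m - f n) < e"
    "\<And>m n. M \<le> m \<Longrightarrow> M \<le> n \<Longrightarrow> a (g m - g n) < e"
    using C_D[OF assms(1)] C_D[OF assms(2)] by meson
  have "a (f m + g m - (f n + g n)) < e" if "max N M \<le> m" "max N M \<le> n" for m n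
    using a_ultra[of "f m - f n" "g m - g n"] NM(1)[of m n] NM(2)[of m n] that
    by (simp add: algebra_simps)
  then show "\<exists>N. \<forall>m\<ge>N. \<forall>n\<ge>N. a (f m + g m - (f n + g n)) < e"
    by blast
qed

lemma C_diff: "f \<in> C \<Longrightarrow> g \<in> C \<Longrightarrow> (\<lambda>n. f n - g n) \<in> C"
  using C_add[OF _ C_minus, of f g] by simp

lemma Z_minus: "f \<in> Z \<Longrightarrow> (\<lambda>n. - f n) \<in> Z"
  by (simp add: Z_iff)

lemma Z_add: assumes "f \<in> Z" "g \<in> Z" shows "(\<lambda>n. f n + g n) \<in> Z"
  unfolding Z_iff
proof (intro allI impI)
  fix e :: real assume "0 < e"
  show "\<forall>\<^sub>F n in sequentially. a (f n + g n) < e"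
    using Z_D[OF assms(1) \<open>0 < e\<close>] Z_D[OF assms(2) \<open>0 < e\<close>]
  proof eventually_elim
    case (elim n)
    then show ?case
      using a_ultra[of "f n" "g n"] by linarith
  qed
qed

lemma Z_const_iff: "(\<lambda>_. c) \<in> Z \<longleftrightarrow> c = 0"
  by (auto simp: null_sequences_def LIMSEQ_const_iff)

lemma Z_imp_C: assumes "f \<in> Z" shows "f \<in> C"
  unfolding C_iff
proof (intro allI impI)
  fix e :: real assume "0 < e"
  then obtain N where "\<And>n. N \<le> n \<Longrightarrow> a (f n) < e"
    using Z_D[OF assms] by (auto simp: eventually_sequentially)
  then show "\<exists>N. \<forall>m\<ge>N. \<forall>n\<ge>N. a (f m - f n) < e"
    by (meson a_diff le_less_trans max_less_iff_conj)
qed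

lemma C_eventually_bounded:
  assumes "f \<in> C"
  obtains B where "0 < B" "\<forall>\<^sub>F n in sequentially. a (f n) \<le> B"
proof -
  obtain N where N: "\<And>n. N \<le> n \<Longrightarrow> a (f n - f N) < 1"
    using C_D[OF assms, of 1] by auto
  have "a (f n) \<le> max 1 (a (f N))" if "N \<le> n" for n
    using a_ultra[of "f n - f N" "f N"] N[OF that] by simp
  then have "\<forall>\<^sub>F n in sequentially. a (f n) \<le> max 1 (a (f N))"
    by (auto simp: eventually_sequentially)
  then show ?thesis
    by (intro that[of "max 1 (a (f N))"]) auto
qed

lemma Z_mult_C:
  assumes "f \<in> Z" "g \<in> C" shows "(\<lambda>n. f n * g n) \<in> Z"
  unfolding Z_iff
proof (intro allI impI)
  fix e :: real assume "0 < e"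
  obtain B where B: "0 < B" "\<forall>\<^sub>F n in sequentially. a (g n) \<le> B"
    using C_eventually_bounded[OF assms(2)] .
  then have "\<forall>\<^sub>F n in sequentially. a (f n) < e / B"
    using Z_D[OF assms(1)] \<open>0 < e\<close> by simp
  with B(2) show "\<forall>\<^sub>F n in sequentially. a (f n * g n) < e"
  proof eventually_elim
    case (elim n)
    have "a (f n) * a (g n) \<le> a (f n) * B"
      using elim(1) by (simp add: mult_left_mono)
    also have "\<dots> < e"
      using elim(2) B(1) by (simp add: pos_less_divide_eq)
    finally show ?case
      by (simp add: a_mult)
  qed
qed

lemma C_mult_Z: "f \<in> C \<Longrightarrow> g \<in> Z \<Longrightarrow> (\<lambda>n. f n * g n) \<in> Z"
  using Z_mult_C[of g f] by (simp add: mult.commute)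

text \<open>By the ultrametric inequality small successive differences suffice.\<close>

lemma C_if_successive:
  assumes "\<And>e. 0 < e \<Longrightarrow> \<forall>\<^sub>F n in sequentially. a (f (Suc n) - f n) < e"
  shows "f \<in> C"
  unfolding C_iff
proof (intro allI impI)
  fix e :: real assume "0 < e"
  then obtain N where N: "\<And>n. N \<le> n \<Longrightarrow> a (f (Suc n) - f n) < e"
    using assms by (auto simp: eventually_sequentially)
  have *: "a (f n - f N) < e" if "N \<le> n" for n
    using that
  proof (induction n rule: dec_induct)
    case (step n)
    then show ?case
      using a_ultra[of "f (Suc n) - f n" "f n - f N"] N[of n] by simp
  qed (use \<open>0 < e\<close> in simp)
  have "a (f m - f n) < e" if "N \<le> m" "N \<le> n" for m n
    using a_diff[of "f m - f N" "f n - f N"] *[OF that(1)] *[OF that(2)] by simp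
  then show "\<exists>N. \<forall>m\<ge>N. \<forall>n\<ge>N. a (f m - f n) < e"
    by blast
qed

text \<open>By the product rule the successive differences of the product are sums of products of a
  null sequence and a Cauchy sequence, hence null, which suffices in the ultrametric
  setting.\<close>

lemma C_mult:
  assumes "f \<in> C" "g \<in> C"
  shows "(\<lambda>n. f n * g n) \<in> C"
proof -
  have diffs: "(\<lambda>n. h (Suc n) - h n) \<in> Z" if "h \<in> C" for h
    unfolding Z_iff eventually_sequentially using C_D[OF that] by (meson le_SucI)
  have Suc: "(\<lambda>n. h (Suc n)) \<in> C" if "h \<in> C" for h
    unfolding C_iff using C_D[OF that] by (meson le_SucI)
  have "(\<lambda>n. (f (Suc n) - f n) * g (Suc n) + f n * (g (Suc n) - g n)) \<in> Z"
    by (intro Z_add Z_mult_C C_mult_Z diffs Suc assms)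
  then have "(\<lambda>n. f (Suc n) * g (Suc n) - f n * g n) \<in> Z"
    by (simp add: algebra_simps)
  then show ?thesis
    by (intro C_if_successive) (simp add: Z_iff)
qed

lemma C_power: "f \<in> C \<Longrightarrow> (\<lambda>n. f n ^ k) \<in> C"
  by (induction k) (simp_all add: C_mult)

text \<open>A sequence outside \<open>Z\<close> has terms of value at least some \<open>e\<close>
  arbitrarily far out. Where all differences are below \<open>e\<close>, such a term dominates them
  and \<open>a_add_eq\<close> gives every other term the same value.\<close>

lemma C_dichotomy:
  assumes "f \<in> C" "f \<notin> Z"
  obtains r where "0 < r" "\<forall>\<^sub>F n in sequentially. a (f n) = r"
proof -
  obtain e where e: "0 < e" "\<not> (\<forall>\<^sub>F n in sequentially. a (f n) < e)"
    using assms(2) by (auto simp: Z_iff)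
  obtain N where N: "\<And>m n. N \<le> m \<Longrightarrow> N \<le> n \<Longrightarrow> a (f m - f n) < e"
    using C_D[OF assms(1) e(1)] by blast
  obtain M where M: "N \<le> M" "e \<le> a (f M)"
    using e(2) unfolding eventually_sequentially by (meson not_less)
  have "a (f n) = a (f M)" if "N \<le> n" for n
    using a_add_eq[of "f n - f M" "f M"] N[OF that M(1)] M(2) by simp
  then have "\<forall>\<^sub>F n in sequentially. a (f n) = a (f M)"
    by (auto simp: eventually_sequentially)
  then show ?thesis
    using M(2) e(1) by (intro that[of "a (f M)"]) (linarith, simp)
qed

text \<open>The values are eventually a constant \<open>r > 0\<close>, so inverting divides
  differences by \<open>r * r\<close>. Early terms may vanish; there \<open>inverse 0 = 0\<close>,
  and the second sequence is only eventually zero.\<close>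

lemma C_inverse:
  assumes "f \<in> C" "f \<notin> Z"
  shows "(\<lambda>n. inverse (f n)) \<in> C" and "(\<lambda>n. f n * inverse (f n) - 1) \<in> Z"
proof -
  obtain r where r: "0 < r" "\<forall>\<^sub>F n in sequentially. a (f n) = r"
    using C_dichotomy[OF assms] .
  then obtain N where N: "\<And>n. N \<le> n \<Longrightarrow> a (f n) = r"
    by (auto simp: eventually_sequentially)
  have nz: "f n \<noteq> 0" if "N \<le> n" for n
    using N[OF that] r(1) by auto
  show "(\<lambda>n. inverse (f n)) \<in> C"
    unfolding C_iff
  proof (intro allI impI)
    fix e :: real assume "0 < e"
    then obtain M where M: "\<And>m n. M \<le> m \<Longrightarrow> M \<le> n \<Longrightarrow> a (f m - f n) < e * (r * r)"
      using C_D[OF assms(1), of "e * (r * r)"] r(1) by auto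
    have "a (inverse (f m) - inverse (f n)) < e" if "max N M \<le> m" "max N M \<le> n" for m n
    proof -
      have "inverse (f m) - inverse (f n) = (f n - f m) / (f m * f n)"
        using nz[of m] nz[of n] that by (simp add: field_simps)
      then have "a (inverse (f m) - inverse (f n)) = a (f n - f m) / (r * r)"
        using N[of m] N[of n] that by (simp add: a_divide a_mult)
      then show ?thesis
        using M[of n m] that r(1) by (simp add: pos_divide_less_eq)
    qed
    then show "\<exists>N. \<forall>m\<ge>N. \<forall>n\<ge>N. a (inverse (f m) - inverse (f n)) < e"
      by blast
  qed
  have "\<forall>\<^sub>F n in sequentially. f n * inverse (f n) - 1 = 0"
    unfolding eventually_sequentially by (intro exI[of _ N]) (simp add: nz)
  then show "(\<lambda>n. f n * inverse (f n) - 1) \<in> Z"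
    unfolding Z_iff by (auto elim: eventually_mono)
qed

text \<open>Newton's method in the form \<open>g \<mapsto> f - g\<^sup>2\<close>, run along the sequence \<open>f\<close>; it works in every
  residue characteristic.\<close>

lemma artin_schreier_solvable:
  assumes f: "f \<in> C" and r: "0 \<le> r" "r < 1" "\<forall>\<^sub>F n in sequentially. a (f n) \<le> r"
  shows "\<exists>g\<in>C. (\<lambda>n. g n * g n + g n - f n) \<in> Z"
proof -
  \<comment> \<open>Where \<open>a (f n) > r\<close> the iteration is reset to 0, so that the bound
    \<open>g_le\<close> holds for every index and not only eventually.\<close>
  define g where "g = rec_nat 0 (\<lambda>n x. if a (f n) \<le> r then f n - x * x else 0)"
  have g_Suc: "g (Suc n) = (if a (f n) \<le> r then f n - g n * g n else 0)" and g_0: "g 0 = 0" for n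
    by (simp_all add: g_def)
  have g_le: "a (g n) \<le> r" for n
  proof (induction n)
    case (Suc n)
    have "a (g n) * a (g n) \<le> 1 * r"
      using Suc r(2) by (intro mult_mono) auto
    then show ?case
      using a_diff[of "f n" "g n * g n"] r(1) by (auto simp: g_Suc a_mult)
  qed (simp add: g_0 r(1))
  obtain N where N: "\<And>n. N \<le> n \<Longrightarrow> a (f n) \<le> r"
    using r(3) by (auto simp: eventually_sequentially)
  have small: "\<forall>\<^sub>F n in sequentially. a (g (Suc n) - g n) < e" if "0 < e" for e
  proof -
    obtain M where M: "N \<le> M" "\<And>n. M \<le> n \<Longrightarrow> a (f (Suc n) - f n) < e / 2"
    proof -
      obtain M' where "\<forall>m\<ge>M'. \<forall>n\<ge>M'. a (f m - f n) < e / 2"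
        using C_D[OF f, of "e / 2"] that \<open>0 < e\<close> by auto
      then show thesis
        using that[of "max N M'"] by simp
    qed
    \<comment> \<open>Each step contracts the difference by the factor \<open>r\<close>, up to the
      movement of \<open>f\<close>, which is below \<open>e / 2\<close> from \<open>M\<close>
      on.\<close>
    have *: "a (g (Suc (M + k)) - g (M + k)) \<le> max (e / 2) (r ^ k)" for k
    proof (induction k)
      case 0
      show ?case
        using a_diff[of "g (Suc M)" "g M"] g_le[of "Suc M"] g_le[of M] r(2) by simp
    next
      case (Suc k)
      let ?m = "M + k"
      \<comment> \<open>Both iterates satisfy the recursion; subtracting gives a difference of
        squares, whose second factor has value at most \<open>r\<close>.\<close>
      have eq: "g (Suc (Suc ?m)) - g (Suc ?m) =
          (f (Suc ?m) - f ?m) - (g (Suc ?m) - g ?m) * (g (Suc ?m) + g ?m)"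
        using N[of ?m] N[of "Suc ?m"] M(1) by (simp add: g_Suc[of "Suc ?m"] g_Suc[of ?m] algebra_simps)
      have "a (g (Suc ?m) + g ?m) \<le> r"
        using a_ultra[of "g (Suc ?m)" "g ?m"] g_le[of "Suc ?m"] g_le[of ?m] by linarith
      then have "a ((g (Suc ?m) - g ?m) * (g (Suc ?m) + g ?m)) \<le> max (e / 2) (r ^ k) * r"
        unfolding a_mult by (intro mult_mono Suc.IH) (use \<open>0 < e\<close> in auto)
      also have "\<dots> = max (e / 2 * r) (r ^ Suc k)"
        unfolding max_mult_distrib_right power_Suc2 using r(1) by simp
      also have "\<dots> \<le> max (e / 2) (r ^ Suc k)"
        using r \<open>0 < e\<close> by (intro max.mono) (auto simp: mult_left_le)
      finally show ?case
        using a_diff[of "f (Suc ?m) - f ?m" "(g (Suc ?m) - g ?m) * (g (Suc ?m) + g ?m)"]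
          M(2)[of ?m] unfolding add_Suc_right eq by linarith
    qed
    obtain k where k: "r ^ k < e"
      using real_arch_pow_inv[OF \<open>0 < e\<close> r(2)] by blast
    have "a (g (Suc n) - g n) < e" if "M + k \<le> n" for n
    proof -
      have "r ^ (n - M) \<le> r ^ k"
        using that r by (intro power_decreasing) auto
      then show ?thesis
        using *[of "n - M"] k \<open>0 < e\<close> that by simp
    qed
    then show ?thesis
      by (auto simp: eventually_sequentially)
  qed
  have "(\<lambda>n. g n * g n + g n - f n) \<in> Z"
    unfolding Z_iff
  proof (intro allI impI)
    fix e :: real assume "0 < e"
    have "\<forall>\<^sub>F n in sequentially. N \<le> n"
      by (rule eventually_ge_at_top)
    then show "\<forall>\<^sub>F n in sequentially. a (g n * g n + g n - f n) < e"
      using small[OF \<open>0 < e\<close>]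
    proof eventually_elim
      case (elim n)
      \<comment> \<open>The defect of the equation at \<open>n\<close> is the negated next
        increment.\<close>
      have "g n * g n + g n - f n = - (g (Suc n) - g n)"
        using N[OF elim(1)] by (simp add: g_Suc)
      then have "a (g n * g n + g n - f n) = a (g (Suc n) - g n)"
        by (simp only: a_minus)
      then show ?case
        using elim(2) by simp
    qed
  qed
  moreover have "g \<in> C"
    using small by (rule C_if_successive)
  ultimately show ?thesis
    by blast
qed

text \<open>A nonzero term of largest value equals minus the sum of the others. If those all had
  strictly smaller value, so would their sum by \<open>a_sum_less\<close>.\<close>

lemma zero_sum_maximum_twice:
  assumes "finite A" "sum t A = 0" "i \<in> A" "t i \<noteq> 0"
  obtains i j where "i \<in> A" "j \<in> A" "i \<noteq> j" "t i \<noteq> 0" "a (t i) = a (t j)"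
proof -
  obtain k where k: "k \<in> A" "\<And>j. j \<in> A \<Longrightarrow> a (t j) \<le> a (t k)"
  proof -
    have fin: "finite ((\<lambda>j. a (t j)) ` A)" and ne: "(\<lambda>j. a (t j)) ` A \<noteq> {}"
      using assms(1,3) by auto
    obtain k where "k \<in> A" "a (t k) = Max ((\<lambda>j. a (t j)) ` A)"
      using Max_in[OF fin ne] by auto
    then show thesis
      using that[of k] Max_ge[OF fin] by auto
  qed
  have pos: "0 < a (t k)"
    using k(2)[OF assms(3)] assms(4) a_pos_iff[of "t i"] by linarith
  have "t k = - sum t (A - {k})"
    using assms(2) sum.remove[OF assms(1) k(1), of t] by (simp add: eq_neg_iff_add_eq_0)
  then have "a (t k) = a (sum t (A - {k}))"
    by simp
  then have "\<exists>j\<in>A - {k}. \<not> a (t j) < a (t k)"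
    using a_sum_less[of "A - {k}" "a (t k)" t] assms(1) pos by auto
  then obtain j where "j \<in> A" "j \<noteq> k" "a (t j) = a (t k)"
    using k(2) by force
  then show ?thesis
    using k(1) pos that[of k j] by simp
qed

text \<open>Valuation rings are integrally closed: if \<open>y\<close> is not in \<open>T\<close>,
  then \<open>w = 1 / y\<close> is, and multiplying the monic relation by \<open>w ^ (d - 1)\<close>
  expresses \<open>y\<close> through elements of \<open>T\<close>. The relation may have an error of
  value below 1, since such errors lie in \<open>T\<close> as well.\<close>

lemma valuation_subring_superset:
  assumes one: "1 \<in> T" and minus_one: "-1 \<in> T"
    and add_mult: "\<And>x y z. x \<in> T \<Longrightarrow> y \<in> T \<Longrightarrow> z \<in> T \<Longrightarrow> x + y * z \<in> T"
    and inv: "\<And>x. x \<notin> T \<Longrightarrow> inverse x \<in> T"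
    and small: "\<And>x. a x < 1 \<Longrightarrow> x \<in> T"
    and monic: "a (y ^ d + (\<Sum>i<d. of_int (e i) * y ^ i)) < 1"
  shows "y \<in> T"
proof (rule ccontr)
  assume y: "y \<notin> T"
  define w where "w = inverse y"
  have w: "w \<in> T"
    using inv[OF y] by (simp add: w_def)
  have zero: "0 \<in> T"
    by (rule small) simp
  have mult: "x * z \<in> T" if "x \<in> T" "z \<in> T" for x z
    using add_mult[OF zero that] by simp
  have add: "x + z \<in> T" if "x \<in> T" "z \<in> T" for x z
    using add_mult[OF that one] by simp
  have minus: "- x \<in> T" if "x \<in> T" for x
    using mult[OF minus_one that] by simp
  have power: "x ^ k \<in> T" if "x \<in> T" for x k
    by (induction k) (simp_all add: one mult that)
  have of_nat: "of_nat k \<in> T" for k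
    by (induction k) (simp_all add: zero one add)
  have of_int: "of_int k \<in> T" for k
    by (cases k rule: int_cases2) (simp_all add: of_nat minus)
  have sum: "sum g B \<in> T" if "\<And>i. i \<in> B \<Longrightarrow> g i \<in> T" for g and B :: "nat set"
    using that by (induction B rule: infinite_finite_induct) (simp_all add: zero add)
  have y0: "y \<noteq> 0"
    using y zero by blast
  \<comment> \<open>For \<open>d = 0\<close> the expression in \<open>monic\<close> is 1, whose
    value is not below 1.\<close>
  have d: "d \<noteq> 0"
    using monic by (intro notI) simp
  have cancel: "y ^ i * w ^ (d - 1) = w ^ (d - 1 - i)" if "i < d" for i
  proof -
    have "w ^ (d - 1) = w ^ i * w ^ (d - 1 - i)"
      using that by (simp flip: power_add)
    moreover have "y ^ i * w ^ i = 1"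
      using y0 by (simp add: w_def flip: power_mult_distrib)
    ultimately show ?thesis
      by (simp flip: mult.assoc)
  qed
  have "y ^ d * w ^ (d - 1) = y"
    using cancel[of "d - 1"] d by (cases d) (simp_all add: mult.assoc)
  then have "y = (y ^ d + (\<Sum>i<d. of_int (e i) * y ^ i)) * w ^ (d - 1)
      - (\<Sum>i<d. of_int (e i) * (y ^ i * w ^ (d - 1)))"
    by (simp add: algebra_simps sum_distrib_left)
  also have "\<dots> = (y ^ d + (\<Sum>i<d. of_int (e i) * y ^ i)) * w ^ (d - 1)
      + - (\<Sum>i<d. of_int (e i) * w ^ (d - 1 - i))"
    using sum.cong[of "{..<d}" "{..<d}" "\<lambda>i. of_int (e i) * (y ^ i * w ^ (d - 1))"
        "\<lambda>i. of_int (e i) * w ^ (d - 1 - i)"] cancel by simp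
  also have "\<dots> \<in> T"
    by (intro add minus mult sum power small monic of_int w)
  finally show False
    using y by blast
qed

end

section \<open>Integer relations and discreteness of places of a number field\<close>

lemma clear_denominators:
  fixes q :: "nat \<Rightarrow> rat"
  shows "\<exists>D>0. \<exists>c. \<forall>i\<le>n. q i * of_int D = of_int (c i)"
proof (induction n)
  case 0
  obtain z D where "q 0 = of_int z / of_int D" "0 < D"
    by (metis quotient_of_denom_pos' quotient_of_div surj_pair snd_conv)
  then show ?case
    by (intro exI[of _ D] conjI exI[of _ "\<lambda>_. z"]) auto
next
  case (Suc n)
  then obtain D c where D: "0 < D" "\<And>i. i \<le> n \<Longrightarrow> q i * of_int D = of_int (c i)"
    by blast
  obtain z E where zE: "q (Suc n) = of_int z / of_int E" "0 < E"
    by (metis quotient_of_denom_pos' quotient_of_div surj_pair snd_conv)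
  have "q i * of_int (D * E) = of_int ((\<lambda>i. if i \<le> n then c i * E else z * D) i)" if "i \<le> Suc n" for i
  proof (cases "i \<le> n")
    case True
    then have "q i * of_int (D * E) = (q i * of_int D) * of_int E"
      by simp
    then show ?thesis
      using D(2)[OF True] True by simp
  next
    case False
    then have "i = Suc n"
      using that by simp
    then show ?thesis
      using zE by simp
  qed
  then show ?case
    using D(1) zE(2) by (intro exI[of _ "D * E"] conjI exI[of _ "\<lambda>i. if i \<le> n then c i * E else z * D"]) auto
qed

text \<open>The powers \<open>x ^ 0, ..., x ^ n\<close> are dependent over the rationals when
  \<open>n\<close> is the degree, and clearing denominators gives integer coefficients. The bound
  \<open>n\<close> is common to all \<open>x\<close>, so that \<open>n!\<close> can later serve as a
  common exponent.\<close>

lemma number_field_integer_relation: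
  assumes "number_field TYPE('k::field_char_0)"
  shows "\<exists>n. \<forall>x::'k. \<exists>c :: nat \<Rightarrow> int. (\<exists>i\<le>n. c i \<noteq> 0) \<and> (\<Sum>i\<le>n. of_int (c i) * x ^ i) = 0"
proof -
  obtain B where "finite_dimensional_vector_space (\<lambda>(q::rat) (x::'k). of_rat q * x) B"
    using assms by (auto simp: number_field_def)
  then interpret V: finite_dimensional_vector_space "\<lambda>(q::rat) (x::'k). of_rat q * x" B .
  let ?n = "V.dim UNIV"
  have "\<exists>c :: nat \<Rightarrow> int. (\<exists>i\<le>?n. c i \<noteq> 0) \<and> (\<Sum>i\<le>?n. of_int (c i) * x ^ i) = 0" for x :: 'k
  proof (cases "inj_on (\<lambda>i. x ^ i) {..?n}")
    case True
    let ?P = "(\<lambda>i. x ^ i) ` {..?n}"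
    have "card ?P = Suc ?n"
      using True by (simp add: card_image)
    then have "V.dependent ?P"
      using V.independent_card_le_dim[of ?P UNIV] by auto
    then obtain u where u: "\<exists>v\<in>?P. u v \<noteq> 0" "(\<Sum>v\<in>?P. of_rat (u v) * v) = 0"
      by (auto simp: V.dependent_finite)
    have u0: "(\<Sum>i\<le>?n. of_rat (u (x ^ i)) * x ^ i) = 0"
      using u(2) True by (simp add: sum.reindex)
    obtain D c where D: "0 < D" "\<And>i. i \<le> ?n \<Longrightarrow> u (x ^ i) * of_int D = of_int (c i)"
      using clear_denominators[of ?n "\<lambda>i. u (x ^ i)"] by blast
    have "(\<Sum>i\<le>?n. of_int (c i) * x ^ i) = (\<Sum>i\<le>?n. of_rat (u (x ^ i) * of_int D) * x ^ i)"
      by (intro sum.cong) (simp_all add: D(2))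
    also have "\<dots> = of_int D * (\<Sum>i\<le>?n. of_rat (u (x ^ i)) * x ^ i)"
      by (simp add: of_rat_mult sum_distrib_left algebra_simps)
    finally have "(\<Sum>i\<le>?n. of_int (c i) * x ^ i) = 0"
      using u0 by simp
    moreover obtain i where i: "i \<le> ?n" "u (x ^ i) \<noteq> 0"
      using u(1) by auto
    then have "c i \<noteq> 0"
      using D(2)[OF i(1)] D(1) by auto
    ultimately show ?thesis
      using i(1) by blast
  next
    case False
    then obtain i j where ij: "i \<le> ?n" "j \<le> ?n" "i \<noteq> j" "x ^ i = x ^ j"
      by (auto simp: inj_on_def)
    \<comment> \<open>Linear dependence is a property of sets, so coinciding powers are treated
      apart: their difference is the relation.\<close>
    let ?c = "\<lambda>k. if k = i then 1 else if k = j then -1 else 0 :: int"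
    have "(\<Sum>k\<le>?n. of_int (?c k) * x ^ k) = (\<Sum>k\<in>{i, j}. of_int (?c k) * x ^ k)"
      using ij(1,2) by (intro sum.mono_neutral_right) auto
    also have "\<dots> = 0"
      using ij(3,4) by simp
    finally show ?thesis
      using ij(1) by (intro exI[of _ ?c]) auto
  qed
  then show ?thesis
    by blast
qed

text \<open>The number field enters through these relations of bounded degree; they control the
  residue characteristic, the value group and the residue field.\<close>

locale number_field_abs = nonarch_field a for a :: "'k::field_char_0 \<Rightarrow> real" +
  fixes n :: nat
  assumes relation: "\<exists>c :: nat \<Rightarrow> int. (\<exists>i\<le>n. c i \<noteq> 0) \<and> (\<Sum>i\<le>n. of_int (c i) * (x :: 'k) ^ i) = 0"
begin

text \<open>Two terms of the integer relation share the largest value, giving a slope of the Newton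
  polygon. Ordering the indices loses nothing by symmetry.\<close>

lemma relation_abs:
  fixes x :: 'k
  assumes "x \<noteq> 0"
  obtains c i j where "i < j" "j \<le> n" "c i \<noteq> 0" "c j \<noteq> 0"
    "a (of_int (c i)) * a x ^ i = a (of_int (c j)) * a x ^ j"
proof -
  obtain c :: "nat \<Rightarrow> int" and k where c: "k \<le> n" "c k \<noteq> 0" "(\<Sum>i\<le>n. of_int (c i) * x ^ i) = 0"
    using relation by blast
  obtain i j where ij: "i \<le> n" "j \<le> n" "i \<noteq> j" "of_int (c i) * x ^ i \<noteq> 0"
    "a (of_int (c i) * x ^ i) = a (of_int (c j) * x ^ j)"
    using zero_sum_maximum_twice[of "{..n}" "\<lambda>i. of_int (c i) * x ^ i" k] c assms by auto
  have nz: "c i \<noteq> 0" "c j \<noteq> 0"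
    using ij(4,5) by auto
  have eq: "a (of_int (c i)) * a x ^ i = a (of_int (c j)) * a x ^ j"
    using ij(5) by (simp add: a_mult a_power)
  show ?thesis
  proof (cases "i < j")
    case True
    show ?thesis
      by (rule that[OF True ij(2) nz eq])
  next
    case False
    then have "j < i"
      using ij(3) by simp
    then show ?thesis
      by (rule that[OF _ ij(1) nz(2,1) eq[symmetric]])
  qed
qed

text \<open>If every nonzero integer had value 1, a relation for an \<open>x\<close> with
  \<open>a x \<noteq> 1\<close> would give \<open>a x ^ i = a x ^ j\<close> with
  \<open>i < j\<close>, forcing \<open>a x = 1\<close>.\<close>

lemma ex_nat_small: "\<exists>m::nat. 0 < m \<and> a (of_nat m) < 1"
proof (rule ccontr)
  assume "\<not> ?thesis"
  then have nat: "a (of_nat m) = 1" if "0 < m" for m :: nat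
    using a_of_nat_le_1[of m] that by (meson antisym not_less)
  have int: "a (of_int m) = 1" if "m \<noteq> 0" for m :: int
    using that nat by (cases m rule: int_cases2) auto
  obtain x where x: "x \<noteq> 0" "a x \<noteq> 1"
    using a_nontrivial by blast
  then obtain c i j where "i < j" "c i \<noteq> 0" "c j \<noteq> 0"
    "a (of_int (c i)) * a x ^ i = a (of_int (c j)) * a x ^ j"
    using relation_abs by metis
  then have "a x ^ i = a x ^ j" "i < j"
    by (simp_all add: int)
  moreover have "0 < a x"
    using x(1) by simp
  ultimately show False
    using x(2) power_inject_exp'[of "a x" i j] by auto
qed

text \<open>The residue characteristic, that is the rational prime below the place.\<close>

definition p :: nat where "p = (LEAST m. 0 < m \<and> a (of_nat m) < 1)"

lemma p_pos: "0 < p" and a_p: "a (of_nat p) < 1"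
  using LeastI_ex[OF ex_nat_small] by (simp_all add: p_def)

lemma a_less_p: "0 < m \<Longrightarrow> m < p \<Longrightarrow> a (of_nat m) = 1"
  using not_less_Least[of m "\<lambda>m. 0 < m \<and> a (of_nat m) < 1"] a_of_nat_le_1[of m]
  by (auto simp: p_def)

lemma p_gt_1: "1 < p"
  using p_pos a_p by (cases "p = 1") auto

text \<open>Division by \<open>p\<close> leaves a remainder of value 1, by minimality of
  \<open>p\<close>, plus a multiple of \<open>p\<close>, which has smaller value.\<close>

lemma a_nat_not_dvd:
  assumes "\<not> p dvd m" shows "a (of_nat m) = 1"
proof -
  have r: "0 < m mod p" "m mod p < p"
    using assms p_pos by (simp_all add: dvd_eq_mod_eq_0)
  have "a (of_nat (p * (m div p))) \<le> a (of_nat p)"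
    using a_of_nat_le_1[of "m div p"] by (simp add: a_mult mult_left_le)
  then have "a (of_nat (p * (m div p)) + of_nat (m mod p)) = a (of_nat (m mod p))"
    using a_p a_less_p[OF r] by (intro a_add_eq) linarith
  then show ?thesis
    using a_less_p[OF r] by (metis mult_div_mod_eq of_nat_add)
qed

lemma a_int_not_dvd: "\<not> int p dvd m \<Longrightarrow> a (of_int m) = 1"
  by (cases m rule: int_cases2) (auto simp: a_nat_not_dvd)

lemma a_nat_power: "0 < m \<Longrightarrow> \<exists>k. a (of_nat m) = a (of_nat p) ^ k"
proof (induction m rule: less_induct)
  case (less m)
  show ?case
  proof (cases "p dvd m")
    case True
    then obtain q where q: "m = p * q"
      by blast
    then have "0 < q" "q < m"
      using less.prems p_gt_1 by auto
    then obtain k where "a (of_nat q) = a (of_nat p) ^ k"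
      using less.IH by blast
    then show ?thesis
      by (intro exI[of _ "Suc k"]) (simp add: q a_mult)
  next
    case False
    then show ?thesis
      by (intro exI[of _ 0]) (simp add: a_nat_not_dvd)
  qed
qed

lemma a_int_power: "m \<noteq> 0 \<Longrightarrow> \<exists>k. a (of_int m) = a (of_nat p) ^ k"
  by (cases m rule: int_cases2) (auto simp: a_nat_power)

text \<open>A relation shows that \<open>a x ^ (j - i)\<close> is a quotient of powers of
  \<open>a (of_nat p)\<close>. The exponent \<open>j - i\<close> varies with \<open>x\<close> but
  divides \<open>n!\<close>, so one exponent serves for all \<open>x\<close>: ramification is
  bounded.\<close>

lemma a_fact_power:
  assumes "x \<noteq> 0" "a x < 1"
  shows "\<exists>k>0. a x ^ fact n = a (of_nat p) ^ k"
proof -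
  let ?r = "a (of_nat p)"
  have r: "0 < ?r" "?r < 1"
    using p_pos a_p by simp_all
  obtain c i j where ij: "i < j" "j \<le> n" "c i \<noteq> 0" "c j \<noteq> 0"
    "a (of_int (c i)) * a x ^ i = a (of_int (c j)) * a x ^ j"
    using relation_abs[OF assms(1)] .
  obtain k l where kl: "a (of_int (c i)) = ?r ^ k" "a (of_int (c j)) = ?r ^ l"
    using a_int_power ij(3,4) by blast
  have "a x ^ j = a x ^ i * a x ^ (j - i)"
    using ij(1) by (simp flip: power_add)
  then have "?r ^ k = ?r ^ l * a x ^ (j - i)"
    using ij(5) assms(1) by (simp add: kl)
  moreover have "j - i dvd (fact n :: nat)"
    using ij(1,2) by (intro dvd_fact) auto
  then obtain q where q: "(fact n :: nat) = (j - i) * q"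
    by (rule dvdE)
  ultimately have eq: "?r ^ (k * q) = ?r ^ (l * q) * a x ^ fact n"
    by (simp add: q power_mult power_mult_distrib)
  have "a x ^ fact n < 1"
    using assms by (simp add: power_less_one_iff)
  then have "?r ^ (l * q) * a x ^ fact n < ?r ^ (l * q) * 1"
    using r(1) by (intro mult_strict_left_mono) auto
  then have "?r ^ (k * q) < ?r ^ (l * q)"
    using eq by simp
  then have "l * q < k * q"
    using r by (simp add: power_strict_decreasing_iff)
  moreover have "?r ^ (k * q) = ?r ^ (l * q) * ?r ^ (k * q - l * q)"
    using calculation by (simp flip: power_add)
  ultimately show ?thesis
    using eq r(1) by (intro exI[of _ "k * q - l * q"]) simp
qed

text \<open>Raising to the power \<open>n!\<close> embeds the nonzero values below 1 monotonically
  into the powers of \<open>a (of_nat p)\<close> with positive exponent, so the smallest exponent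
  that occurs gives the largest value.\<close>

lemma ex_uniformizer: "\<exists>\<pi>. 0 < a \<pi> \<and> a \<pi> < 1 \<and> (\<forall>y. a y < 1 \<longrightarrow> a y \<le> a \<pi>)"
proof -
  let ?r = "a (of_nat p)"
  have r: "0 < ?r" "?r < 1"
    using p_pos a_p by simp_all
  let ?Q = "\<lambda>k. 0 < k \<and> (\<exists>x. x \<noteq> 0 \<and> a x ^ fact n = ?r ^ k)"
  define k where "k = (LEAST k. ?Q k)"
  have "?Q (fact n)"
    using p_pos by (auto intro!: exI[of _ "of_nat p"])
  then have "?Q k"
    unfolding k_def by (rule LeastI)
  then obtain \<pi> where \<pi>: "0 < k" "\<pi> \<noteq> 0" "a \<pi> ^ fact n = ?r ^ k"
    by blast
  have fact: "fact n = Suc (fact n - 1)"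
    by simp
  have "a \<pi> ^ fact n < 1"
    using \<pi>(1,3) r by (simp add: power_less_one_iff)
  then have "a \<pi> < 1"
    by (meson a_nonneg not_less one_le_power)
  moreover have "a y \<le> a \<pi>" if y: "a y < 1" for y
  proof (cases "y = 0")
    case False
    then obtain l where l: "0 < l" "a y ^ fact n = ?r ^ l"
      using a_fact_power y by blast
    then have "k \<le> l"
      using False unfolding k_def by (intro Least_le) blast
    then have "a y ^ fact n \<le> a \<pi> ^ fact n"
      using l(2) \<pi>(3) r by (simp add: power_decreasing)
    then show ?thesis
      using fact by (metis a_nonneg power_le_imp_le_base)
  qed simp
  ultimately show ?thesis
    using \<pi>(2) by auto
qed

text \<open>The residue field is algebraic over its prime field. In an integer relation with minimal
  coefficients not all are divisible by \<open>p\<close>; with \<open>d\<close> the last index where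
  \<open>c d\<close> is not, all later terms have value below 1, and multiplying by an inverse of
  \<open>c d\<close> modulo \<open>p\<close> makes the remaining relation monic.\<close>

lemma ex_monic_relation:
  assumes y: "a y \<le> 1"
  obtains d and e :: "nat \<Rightarrow> int" where "a (y ^ d + (\<Sum>i<d. of_int (e i) * y ^ i)) < 1"
proof -
  let ?rel = "\<lambda>c :: nat \<Rightarrow> int. (\<exists>i\<le>n. c i \<noteq> 0) \<and> (\<Sum>i\<le>n. of_int (c i) * y ^ i) = 0"
  \<comment> \<open>Minimality of the total size of the coefficients excludes a common factor
    \<open>p\<close>, since dividing by it gives a smaller relation.\<close>
  obtain c where c: "?rel c"
    "\<And>c'. ?rel c' \<Longrightarrow> (\<Sum>i\<le>n. nat \<bar>c i\<bar>) \<le> (\<Sum>i\<le>n. nat \<bar>c' i\<bar>)"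
    using ex_has_least_nat[of ?rel _ "\<lambda>c. \<Sum>i\<le>n. nat \<bar>c i\<bar>"] relation[of y] by blast
  have "\<exists>i\<le>n. \<not> int p dvd c i"
  proof (rule ccontr)
    assume "\<not> ?thesis"
    then have "\<forall>i. \<exists>b. i \<le> n \<longrightarrow> c i = int p * b"
      by (auto simp: dvd_def)
    then obtain b where b: "\<And>i. i \<le> n \<Longrightarrow> c i = int p * b i"
      by metis
    have "(\<Sum>i\<le>n. of_int (c i) * y ^ i) = of_nat p * (\<Sum>i\<le>n. of_int (b i) * y ^ i)"
      by (simp add: b sum_distrib_left mult.assoc)
    then have "?rel b"
      using c(1) b p_pos by auto
    moreover have "(\<Sum>i\<le>n. nat \<bar>b i\<bar>) < (\<Sum>i\<le>n. nat \<bar>c i\<bar>)"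
    proof (rule sum_strict_mono_ex1)
      show "\<forall>i\<in>{..n}. nat \<bar>b i\<bar> \<le> nat \<bar>c i\<bar>"
        using b p_pos by (auto simp: abs_mult nat_mult_distrib)
      obtain i where "i \<le> n" "b i \<noteq> 0"
        using \<open>?rel b\<close> by blast
      then show "\<exists>i\<in>{..n}. nat \<bar>b i\<bar> < nat \<bar>c i\<bar>"
        using b p_gt_1 by (intro bexI[of _ i]) (auto simp: abs_mult nat_mult_distrib)
    qed simp
    ultimately show False
      using c(2)[of b] by simp
  qed
  then have fin: "finite {i. i \<le> n \<and> \<not> int p dvd c i}" and ne: "{i. i \<le> n \<and> \<not> int p dvd c i} \<noteq> {}"
    by auto
  define d where "d = Max {i. i \<le> n \<and> \<not> int p dvd c i}"
  have d: "d \<le> n" "\<not> int p dvd c d"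
    using Max_in[OF fin ne] by (simp_all add: d_def)
  have above: "a (of_int (c i)) < 1" if "d < i" "i \<le> n" for i
  proof -
    have "int p dvd c i"
    proof (rule ccontr)
      assume "\<not> int p dvd c i"
      then have "i \<le> d"
        unfolding d_def using that(2) by (intro Max_ge[OF fin]) simp
      then show False
        using that(1) by simp
    qed
    then obtain b where "c i = int p * b"
      by (rule dvdE)
    then show ?thesis
      using a_mult_less_1[OF a_p a_of_int_le_1[of b]] by simp
  qed
  \<comment> \<open>\<open>g = 1\<close> follows from the minimality of \<open>p\<close>: as
    \<open>c d\<close> has value 1, so has its divisor \<open>g\<close>; hence
    \<open>h = p / g\<close> has the same value as \<open>p\<close>, which is below 1, and so
    \<open>h\<close> cannot be smaller than \<open>p\<close>.\<close>
  define g where "g = gcd (c d) (int p)"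
  obtain h where h: "int p = g * h"
    unfolding g_def by (rule dvdE[OF gcd_dvd2])
  have g: "0 < g"
    using p_pos by (simp add: g_def)
  have hpos: "0 < h"
    using h g p_pos zero_less_mult_pos[of g h] by simp
  obtain c' where c': "c d = g * c'"
    unfolding g_def by (rule dvdE[OF gcd_dvd1])
  have "a (of_int g) * a (of_int c') = 1"
    using a_int_not_dvd[OF d(2)] by (simp add: c' a_mult)
  then have "a (of_int g) = 1"
    using a_of_int_le_1[of g] a_of_int_le_1[of c'] mult_right_le_one_le[of "a (of_int g)" "a (of_int c')"]
    by simp
  moreover have "a (of_int (int p)) = a (of_int g) * a (of_int h)"
    unfolding h by (simp add: a_mult)
  ultimately have "a (of_int h) = a (of_nat p)"
    by simp
  then have "\<not> nat h < p"
    using a_less_p[of "nat h"] a_p hpos by auto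
  then have "g = 1"
  proof -
    have "g * h \<le> 1 * h"
      using \<open>\<not> nat h < p\<close> h hpos by linarith
    then show ?thesis
      using g hpos by (simp add: mult_le_cancel_right)
  qed
  then obtain u v where uv: "u * c d + v * int p = 1"
    using bezout_int[of "c d" "int p"] by (auto simp: g_def)
  \<comment> \<open>\<open>u\<close> inverts \<open>c d\<close> modulo \<open>p\<close>, so
    \<open>u * c d\<close> differs from 1 by a multiple of \<open>p\<close>.\<close>
  define e where "e i = u * c i" for i
  have u_small: "a (1 - of_int (u * c d)) < 1"
  proof -
    have "1 - u * c d = v * int p"
      using uv by simp
    then have "of_int (1 - u * c d) = (of_int (v * int p) :: 'k)"
      by simp
    then have "1 - of_int (u * c d) = (of_nat p * of_int v :: 'k)"
      by (simp add: mult.commute)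
    then show ?thesis
      using a_mult_less_1[OF a_p a_of_int_le_1[of v]] by simp
  qed
  have ypow: "a (y ^ i) \<le> 1" for i
    using y by (simp add: a_power power_le_one)
  have "{..n} = {..<d} \<union> {d} \<union> {d<..n}"
    using d(1) by auto
  then have "(\<Sum>i\<le>n. of_int (c i) * y ^ i) =
      (\<Sum>i<d. of_int (c i) * y ^ i) + of_int (c d) * y ^ d + (\<Sum>i\<in>{d<..n}. of_int (c i) * y ^ i)"
    by (simp add: sum.union_disjoint) (subst sum.union_disjoint, auto)
  then have split: "(\<Sum>i<d. of_int (c i) * y ^ i) =
      - of_int (c d) * y ^ d - (\<Sum>i\<in>{d<..n}. of_int (c i) * y ^ i)"
    using c(1) by (simp add: algebra_simps eq_neg_iff_add_eq_0)
  have "(\<Sum>i<d. of_int (e i) * y ^ i) = of_int u * (\<Sum>i<d. of_int (c i) * y ^ i)"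
    by (simp add: e_def sum_distrib_left mult.assoc)
  also have "\<dots> = - of_int (u * c d) * y ^ d - of_int u * (\<Sum>i\<in>{d<..n}. of_int (c i) * y ^ i)"
    unfolding split by (simp add: algebra_simps)
  finally have eq: "y ^ d + (\<Sum>i<d. of_int (e i) * y ^ i) =
      (1 - of_int (u * c d)) * y ^ d - of_int u * (\<Sum>i\<in>{d<..n}. of_int (c i) * y ^ i)"
    by (simp add: algebra_simps)
  have "a (\<Sum>i\<in>{d<..n}. of_int (c i) * y ^ i) < 1"
    using above ypow by (intro a_sum_less a_mult_less_1) auto
  then have "a (of_int u * (\<Sum>i\<in>{d<..n}. of_int (c i) * y ^ i)) < 1"
    using a_mult_less_1 a_of_int_le_1 by (metis mult.commute)
  then have "a (y ^ d + (\<Sum>i<d. of_int (e i) * y ^ i)) < 1"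
    unfolding eq using a_mult_less_1[OF u_small ypow[of d]] a_diff by (meson le_less_trans max_less_iff_conj)
  then show ?thesis
    by (rule that)
qed

end

section \<open>Counting indices up to a finite bound\<close>

text \<open>Infinity is kept apart from every finite count because membership in a restricted
  product is a finiteness condition, which a cut-off count alone could not detect.\<close>

definition trunc_card :: "nat \<Rightarrow> 'i set \<Rightarrow> nat option" where
  "trunc_card J Y = (if finite Y then Some (min J (card Y)) else None)"

lemma trunc_card_antimono:
  "trunc_card J Y = trunc_card J Y' \<Longrightarrow> j \<le> J \<Longrightarrow> trunc_card j Y = trunc_card j Y'"
  by (auto simp: trunc_card_def min_def split: if_splits)

lemma trunc_card_eq_0_iff: "1 \<le> J \<Longrightarrow> trunc_card J Y = Some 0 \<longleftrightarrow> Y = {}"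
  by (auto simp: trunc_card_def min_def)

lemma trunc_card_eq_None_iff: "trunc_card J Y = None \<longleftrightarrow> infinite Y"
  by (simp add: trunc_card_def)

lemma trunc_card_Un:
  assumes "trunc_card J A = trunc_card J A'" "trunc_card J B = trunc_card J B'"
    and "A \<inter> B = {}" "A' \<inter> B' = {}"
  shows "trunc_card J (A \<union> B) = trunc_card J (A' \<union> B')"
proof (cases "finite A \<and> finite B")
  case True
  moreover have "finite A'" "finite B'"
    using assms(1,2) True by (simp_all add: trunc_card_def split: if_splits)
  moreover have "min J (x + y) = min J (min J x + min J y)" for x y :: nat
    by (auto simp: min_def)
  ultimately show ?thesis
    using assms unfolding trunc_card_def
    by (metis card_Un_disjoint finite_Un option.inject)
next
  case False
  then show ?thesis
    using assms(1,2) by (auto simp: trunc_card_def split: if_splits)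
qed

definition same_counts :: "nat \<Rightarrow> 'i set \<Rightarrow> ('i \<Rightarrow> 'c) \<Rightarrow> ('i \<Rightarrow> 'c) \<Rightarrow> bool" where
  "same_counts J I c c' \<longleftrightarrow>
     (\<forall>s. trunc_card J {v\<in>I. c v = s} = trunc_card J {v\<in>I. c' v = s})"

lemma same_counts_sym: "same_counts J I c c' \<Longrightarrow> same_counts J I c' c"
  by (simp add: same_counts_def)

lemma same_counts_antimono: "same_counts J I c c' \<Longrightarrow> j \<le> J \<Longrightarrow> same_counts j I c c'"
  unfolding same_counts_def using trunc_card_antimono by blast

lemma same_counts_nonempty:
  assumes "same_counts J I c c'" "1 \<le> J" "v \<in> I"
  obtains w where "w \<in> I" "c w = c' v"
proof -
  have "{w\<in>I. c' w = c' v} \<noteq> {}"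
    using assms(3) by auto
  then have "{w\<in>I. c w = c' v} \<noteq> {}"
    using assms(1) trunc_card_eq_0_iff[OF assms(2), of "{w\<in>I. c w = c' v}"]
      trunc_card_eq_0_iff[OF assms(2), of "{w\<in>I. c' w = c' v}"]
    by (simp only: same_counts_def not_False_eq_True simp_thms)
  then show ?thesis
    using that by auto
qed

lemma same_counts_vimage:
  assumes "same_counts J I c c'" "finite T"
  shows "trunc_card J {v\<in>I. c v \<in> T} = trunc_card J {v\<in>I. c' v \<in> T}"
  using assms(2)
proof (induction T rule: finite_induct)
  case (insert s T)
  have "{v\<in>I. d v \<in> insert s T} = {v\<in>I. d v = s} \<union> {v\<in>I. d v \<in> T}" for d :: "'a \<Rightarrow> 'b"
    by auto
  moreover have "{v\<in>I. d v = s} \<inter> {v\<in>I. d v \<in> T} = {}" for d :: "'a \<Rightarrow> 'b"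
    using insert.hyps by auto
  moreover have "trunc_card J {v\<in>I. c v = s} = trunc_card J {v\<in>I. c' v = s}"
    using assms(1) by (simp add: same_counts_def)
  ultimately show ?case
    using trunc_card_Un[OF _ insert.IH, of "{v\<in>I. c v = s}" "{v\<in>I. c' v = s}"] by simp
qed simp

lemma same_counts_map:
  assumes "same_counts J I c c'" "finite T" "c ` I \<subseteq> T" "c' ` I \<subseteq> T"
  shows "same_counts J I (\<lambda>v. g (c v)) (\<lambda>v. g (c' v))"
  unfolding same_counts_def
proof
  fix t
  have "{v\<in>I. g (d v) = t} = {v\<in>I. d v \<in> {s\<in>T. g s = t}}" if "d ` I \<subseteq> T" for d
    using that by auto
  then show "trunc_card J {v\<in>I. g (c v) = t} = trunc_card J {v\<in>I. g (c' v) = t}"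
    using same_counts_vimage[OF assms(1), of "{s\<in>T. g s = t}"] assms(2-4) by simp
qed

text \<open>A part with fewer than \<open>J\<close> elements is copied exactly and the rest follows;
  if both parts have at least \<open>J\<close>, then \<open>Z\<close> and so \<open>Z'\<close> have
  at least \<open>2 * J\<close> elements, enough for two parts of size at least \<open>J\<close>.
  This is why the bound doubles.\<close>

lemma split_trunc_card:
  assumes eq: "trunc_card (2 * J) Z = trunc_card (2 * J) Z'" and sub: "A \<subseteq> Z"
  shows "\<exists>A'\<subseteq>Z'. trunc_card J A' = trunc_card J A \<and> trunc_card J (Z' - A') = trunc_card J (Z - A)"
proof (cases "finite Z")
  case True
  have fin: "finite A" "finite (Z - A)"
    using True finite_subset[OF sub] by auto
  have fin': "finite Z'" and eqc: "min (2 * J) (card Z') = min (2 * J) (card Z)"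
    using eq True by (simp_all add: trunc_card_def split: if_splits)
  have Z: "card Z = card A + card (Z - A)"
    using card_Un_disjoint[OF fin] sub by (simp add: Un_absorb1)
  obtain k where k: "k \<le> card Z'" "min J k = min J (card A)"
    "min J (card Z' - k) = min J (card (Z - A))"
  proof -
    consider "card A < J" | "card (Z - A) < J" | "J \<le> card A" "J \<le> card (Z - A)"
      by linarith
    then show ?thesis
    proof cases
      case 1
      show ?thesis
        by (rule that[of "card A"]) (use 1 eqc Z in linarith)+
    next
      case 2
      show ?thesis
        by (rule that[of "card Z' - card (Z - A)"]) (use 2 eqc Z in linarith)+
    next
      case 3
      show ?thesis
        by (rule that[of J]) (use 3 eqc Z in linarith)+
    qed
  qed
  obtain A' where A': "A' \<subseteq> Z'" "card A' = k"
    using obtain_subset_with_card_n[OF k(1)] by blast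
  then have "finite A'" "card (Z' - A') = card Z' - k"
    using fin' finite_subset[of A' Z'] by (auto simp: card_Diff_subset)
  then show ?thesis
    using A' k fin fin' by (intro exI[of _ A']) (simp add: trunc_card_def)
next
  case False
  then have inf: "infinite Z'"
    using eq by (auto simp: trunc_card_def split: if_splits)
  \<comment> \<open>As \<open>Z\<close> is infinite, at most one part is finite; that part is copied
    exactly.\<close>
  consider "finite A" | "finite (Z - A)" | "infinite A" "infinite (Z - A)"
    by blast
  then show ?thesis
  proof cases
    case 1
    obtain A' where "A' \<subseteq> Z'" "finite A'" "card A' = card A"
      using infinite_arbitrarily_large[OF inf] by blast
    then show ?thesis
      using 1 False inf by (intro exI[of _ A']) (simp add: trunc_card_def)
  next
    case 2
    obtain D where D: "D \<subseteq> Z'" "finite D" "card D = card (Z - A)"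
      using infinite_arbitrarily_large[OF inf] by blast
    moreover have "infinite A"
      using 2 False by auto
    ultimately show ?thesis
      using 2 inf by (intro exI[of _ "Z' - D"]) (simp add: trunc_card_def double_diff)
  next
    case 3
    obtain D where "D \<subseteq> Z'" "infinite D" "infinite (Z' - D)"
      using infinite_split[OF inf] by (smt (verit) Diff_iff disjoint_iff finite_subset subset_iff)
    then show ?thesis
      using 3 by (intro exI[of _ D]) (simp add: trunc_card_def)
  qed
qed

text \<open>One colour is split off at a time by \<open>split_trunc_card\<close>, and each split
  halves the available bound; this accounts for the factor \<open>2 ^ card S\<close>.\<close>

lemma color_trunc_card:
  assumes "finite S" "1 \<le> J" "f ` Z \<subseteq> S"
    and "trunc_card (2 ^ card S * J) Z = trunc_card (2 ^ card S * J) Z'"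
  shows "\<exists>f'. \<forall>s. trunc_card J {v\<in>Z'. f' v = s} = trunc_card J {v\<in>Z. f v = s}"
  using assms(1,3,4)
proof (induction S arbitrary: Z Z' rule: finite_induct)
  case empty
  then have "Z = {}"
    by simp
  moreover have "Z' = {}"
    using empty \<open>Z = {}\<close> trunc_card_eq_0_iff[OF assms(2), of Z] trunc_card_eq_0_iff[OF assms(2), of Z']
    by simp
  ultimately show ?case
    by (simp add: trunc_card_def)
next
  case (insert c S)
  define A where "A = {v\<in>Z. f v = c}"
  have "trunc_card (2 * (2 ^ card S * J)) Z = trunc_card (2 * (2 ^ card S * J)) Z'"
    using insert.prems(2) insert.hyps by (simp add: mult.assoc)
  then obtain A' where A': "A' \<subseteq> Z'" "trunc_card (2 ^ card S * J) A' = trunc_card (2 ^ card S * J) A"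
    "trunc_card (2 ^ card S * J) (Z' - A') = trunc_card (2 ^ card S * J) (Z - A)"
    using split_trunc_card[of "2 ^ card S * J" Z Z' A] by (auto simp: A_def)
  have "f ` (Z - A) \<subseteq> S"
    using insert.prems(1) by (auto simp: A_def)
  then obtain f' where f': "\<And>s. trunc_card J {v\<in>Z' - A'. f' v = s} = trunc_card J {v\<in>Z - A. f v = s}"
    using insert.IH[of "Z - A" "Z' - A'"] A'(3) by auto
  define g where "g v = (if v \<in> A' then c else f' v)" for v
  have "trunc_card J {v\<in>Z'. g v = s} = trunc_card J {v\<in>Z. f v = s}" for s
  proof (cases "s = c")
    case True
    have "{v\<in>Z - A. f v = c} = {}"
      by (auto simp: A_def)
    \<comment> \<open>\<open>f'\<close> might also use \<open>c\<close> outside \<open>A'\<close>;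
      its empty count for \<open>c\<close> rules this out, as \<open>J\<close> is at least
      1.\<close>
    then have "{v\<in>Z' - A'. f' v = c} = {}"
      using f'[of c] trunc_card_eq_0_iff[OF assms(2), of "{v\<in>Z - A. f v = c}"]
        trunc_card_eq_0_iff[OF assms(2), of "{v\<in>Z' - A'. f' v = c}"] by simp
    then have "{v\<in>Z'. g v = c} = A'"
      using A'(1) by (auto simp: g_def)
    moreover have "{v\<in>Z. f v = c} = A"
      by (simp add: A_def)
    moreover have "J \<le> 2 ^ card S * J"
      by simp
    ultimately show ?thesis
      using True trunc_card_antimono[OF A'(2)] by simp
  next
    case False
    then have "{v\<in>Z'. g v = s} = {v\<in>Z' - A'. f' v = s}" "{v\<in>Z. f v = s} = {v\<in>Z - A. f v = s}"
      using A'(1) by (auto simp: g_def A_def)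
    then show ?thesis
      using f' by simp
  qed
  then show ?case
    by blast
qed

text \<open>The extension step of the back-and-forth argument: \<open>color_trunc_card\<close>
  colours each fibre of \<open>p'\<close> separately, and the colourings are glued along the value
  of \<open>p'\<close>.\<close>

lemma same_counts_extend:
  assumes "finite S" "1 \<le> J" "f ` I \<subseteq> S" "same_counts (2 ^ card S * J) I p p'"
  obtains f' where "same_counts J I (\<lambda>v. (p v, f v)) (\<lambda>v. (p' v, f' v))"
proof -
  have "\<exists>f'. \<forall>s. trunc_card J {v\<in>{v\<in>I. p' v = t}. f' v = s} =
                  trunc_card J {v\<in>{v\<in>I. p v = t}. f v = s}" for t
  proof (rule color_trunc_card[OF assms(1,2)])
    show "f ` {v\<in>I. p v = t} \<subseteq> S"
      using assms(3) by auto
    show "trunc_card (2 ^ card S * J) {v\<in>I. p v = t} = trunc_card (2 ^ card S * J) {v\<in>I. p' v = t}"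
      using assms(4) unfolding same_counts_def by blast
  qed
  then have "\<exists>F. \<forall>t s. trunc_card J {v\<in>{v\<in>I. p' v = t}. F t v = s} =
                  trunc_card J {v\<in>{v\<in>I. p v = t}. f v = s}"
    by (rule choice[OF allI])
  then obtain F where F: "\<And>t s. trunc_card J {v\<in>{v\<in>I. p' v = t}. F t v = s} =
                  trunc_card J {v\<in>{v\<in>I. p v = t}. f v = s}"
    by blast
  have "trunc_card J {v\<in>I. (p v, f v) = ts} = trunc_card J {v\<in>I. (p' v, F (p' v) v) = ts}" for ts
  proof -
    obtain t s where ts: "ts = (t, s)"
      by (cases ts)
    have "{v\<in>I. (p' v, F (p' v) v) = ts} = {v\<in>{v\<in>I. p' v = t}. F t v = s}"
      "{v\<in>I. (p v, f v) = ts} = {v\<in>{v\<in>I. p v = t}. f v = s}"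
      by (auto simp: ts)
    then show ?thesis
      using F[of t s] by (simp only:)
  qed
  then have "same_counts J I (\<lambda>v. (p v, f v)) (\<lambda>v. (p' v, F (p' v) v))"
    unfolding same_counts_def by (rule allI)
  then show ?thesis
    by (rule that)
qed

section \<open>Definable restricted products\<close>

text \<open>Well-sortedness fixes the lengths of argument lists, so terms can be treated by cases on
  the five operations.\<close>

lemma ring_term_induct [consumes 1, case_names Var RZero ROne RAdd RNeg RMult]:
  assumes "has_sort ring_language t s"
    and "\<And>x. P (Var x)"
    and "P (App RZero [])" and "P (App ROne [])"
    and "\<And>t u. has_sort ring_language t () \<Longrightarrow> has_sort ring_language u () \<Longrightarrow> P t \<Longrightarrow> P u \<Longrightarrow> P (App RAdd [t, u])"
    and "\<And>t. has_sort ring_language t () \<Longrightarrow> P t \<Longrightarrow> P (App RNeg [t])"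
    and "\<And>t u. has_sort ring_language t () \<Longrightarrow> has_sort ring_language u () \<Longrightarrow> P t \<Longrightarrow> P u \<Longrightarrow> P (App RMult [t, u])"
  shows "P t"
  using assms(1)
proof (induction rule: has_sort.induct)
  case (2 f ts)
  then show ?case
    by (cases f) (auto simp: ring_language_def list_all2_Cons2 numeral_2_eq_2 intro: assms)
qed (rule assms)

lemma has_sort_ring_language [simp]:
  "has_sort ring_language (Var x) s"
  "has_sort ring_language (App RZero []) s"
  "has_sort ring_language (App ROne []) s"
  "has_sort ring_language (App RAdd [t, u]) s \<longleftrightarrow>
     has_sort ring_language t () \<and> has_sort ring_language u ()"
  "has_sort ring_language (App RNeg [t]) s \<longleftrightarrow> has_sort ring_language t ()"
  "has_sort ring_language (App RMult [t, u]) s \<longleftrightarrow>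
     has_sort ring_language t () \<and> has_sort ring_language u ()"
  by (cases x, simp_all add: has_sort.simps ring_language_def numeral_2_eq_2)

lemma sorts_ring_language [simp]: "sorts ring_language = {()}"
  and rels_ring_language [simp]: "rels ring_language = {}"
  by (simp_all add: ring_language_def)

lemma ring_structure_simps [simp]:
  "univ (ring_structure R) s = carrier R"
  "fun_int (ring_structure R) = ring_int R"
  by (simp_all add: ring_structure_def)

lemma eval_ring_term_closed:
  assumes "ring R" "has_sort ring_language t ()" "\<And>x. x \<in> term_vars t \<Longrightarrow> \<alpha> x \<in> carrier R"
  shows "eval_term (ring_structure R) \<alpha> t \<in> carrier R"
  using assms(2,3)
proof (induction rule: ring_term_induct)
qed (simp_all add: ring.ring_simprules assms(1))

text \<open>\<open>\<chi>\<close> is the conjunction of the members of \<open>G\<close> in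
  \<open>S\<close> and the negations of the others. It does not depend on the structure, so that one
  formula serves at all indices. Intersecting with \<open>G\<close> admits arbitrary
  \<open>S\<close>.\<close>

lemma ex_pattern_formula:
  assumes "finite G" "\<And>\<phi>. \<phi> \<in> G \<Longrightarrow> formula ring_language \<phi>"
  shows "\<exists>\<chi>. formula ring_language \<chi> \<and> free_vars \<chi> \<subseteq> \<Union> (free_vars ` G) \<and>
    (\<forall>(M :: (unit, ring_symbol, unit, 'u) fo_structure) \<alpha>.
       sat M \<alpha> \<chi> \<longleftrightarrow> {\<phi>\<in>G. sat M \<alpha> \<phi>} = S \<inter> G)"
  using assms
proof (induction G rule: finite_induct)
  case empty
  show ?case
    by (intro exI[of _ "Eq (App RZero []) (App RZero [])"]) auto
next
  case (insert \<phi> G)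
  then obtain \<chi> where \<chi>: "formula ring_language \<chi>" "free_vars \<chi> \<subseteq> \<Union> (free_vars ` G)"
    "\<And>(M :: (unit, ring_symbol, unit, 'u) fo_structure) \<alpha>.
       sat M \<alpha> \<chi> \<longleftrightarrow> {\<phi>\<in>G. sat M \<alpha> \<phi>} = S \<inter> G"
    by auto
  let ?\<chi> = "Conj (if \<phi> \<in> S then \<phi> else Neg \<phi>) \<chi>"
  have "sat M \<alpha> ?\<chi> \<longleftrightarrow> {\<psi>\<in>insert \<phi> G. sat M \<alpha> \<psi>} = S \<inter> insert \<phi> G"
    for M :: "(unit, ring_symbol, unit, 'u) fo_structure" and \<alpha>
  proof -
    have "sat M \<alpha> ?\<chi> \<longleftrightarrow> (sat M \<alpha> \<phi> \<longleftrightarrow> \<phi> \<in> S) \<and> {\<phi>\<in>G. sat M \<alpha> \<phi>} = S \<inter> G"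
      by (simp add: \<chi>(3))
    also have "\<dots> \<longleftrightarrow> {\<psi>\<in>insert \<phi> G. sat M \<alpha> \<psi>} = S \<inter> insert \<phi> G"
      using insert.hyps by blast
    finally show ?thesis .
  qed
  moreover have "formula ring_language ?\<chi>" "free_vars ?\<chi> \<subseteq> \<Union> (free_vars ` insert \<phi> G)"
    using \<chi>(1,2) insert.prems by auto
  ultimately show ?case
    by blast
qed

text \<open>The formula \<open>\<theta> n\<close> defines \<open>B i\<close> uniformly in
  \<open>i\<close>. A family indexed by the variable is used because \<open>\<theta>\<close> has to
  speak about whichever variable is quantified.\<close>

locale definable_restricted_product =
  fixes I :: "'i set" and R :: "'i \<Rightarrow> 'a ring" and B :: "'i \<Rightarrow> 'a set"
    and \<theta> :: "nat \<Rightarrow> (unit, ring_symbol, unit) fo_form"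
  assumes ring: "i \<in> I \<Longrightarrow> ring (R i)"
    and B_carrier: "i \<in> I \<Longrightarrow> B i \<subseteq> carrier (R i)"
    and B_zero: "i \<in> I \<Longrightarrow> \<zero>\<^bsub>R i\<^esub> \<in> B i"
    and B_one: "i \<in> I \<Longrightarrow> \<one>\<^bsub>R i\<^esub> \<in> B i"
    and B_minus: "i \<in> I \<Longrightarrow> x \<in> B i \<Longrightarrow> \<ominus>\<^bsub>R i\<^esub> x \<in> B i"
    and B_add: "i \<in> I \<Longrightarrow> x \<in> B i \<Longrightarrow> y \<in> B i \<Longrightarrow> x \<oplus>\<^bsub>R i\<^esub> y \<in> B i"
    and B_mult: "i \<in> I \<Longrightarrow> x \<in> B i \<Longrightarrow> y \<in> B i \<Longrightarrow> x \<otimes>\<^bsub>R i\<^esub> y \<in> B i"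
    and formula_\<theta>: "formula ring_language (\<theta> n)"
    and free_vars_\<theta>: "free_vars (\<theta> n) \<subseteq> {((), n)}"
    and sat_\<theta>: "i \<in> I \<Longrightarrow> \<alpha> ((), n) \<in> carrier (R i) \<Longrightarrow>
      sat (ring_structure (R i)) \<alpha> (\<theta> n) \<longleftrightarrow> \<alpha> ((), n) \<in> B i"
begin

abbreviation A where "A \<equiv> restricted_product I R B"

lemma A_iff: "x \<in> carrier A \<longleftrightarrow> x \<in> Pi\<^sub>E I (\<lambda>i. carrier (R i)) \<and> finite {i\<in>I. x i \<notin> B i}"
  by (simp add: restricted_product_def)

lemma A_component: "x \<in> carrier A \<Longrightarrow> i \<in> I \<Longrightarrow> x i \<in> carrier (R i)"
  by (auto simp: A_iff)

lemma A_simps: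
  "\<zero>\<^bsub>A\<^esub> = (\<lambda>i\<in>I. \<zero>\<^bsub>R i\<^esub>)" "\<one>\<^bsub>A\<^esub> = (\<lambda>i\<in>I. \<one>\<^bsub>R i\<^esub>)"
  "x \<oplus>\<^bsub>A\<^esub> y = (\<lambda>i\<in>I. x i \<oplus>\<^bsub>R i\<^esub> y i)" "x \<otimes>\<^bsub>A\<^esub> y = (\<lambda>i\<in>I. x i \<otimes>\<^bsub>R i\<^esub> y i)"
  by (simp_all add: restricted_product_def)

lemma A_eqI: "x \<in> carrier A \<Longrightarrow> y \<in> carrier A \<Longrightarrow> (\<And>i. i \<in> I \<Longrightarrow> x i = y i) \<Longrightarrow> x = y"
  by (auto simp: A_iff intro: PiE_ext)

lemma A_memI:
  assumes "\<And>i. i \<in> I \<Longrightarrow> f i \<in> carrier (R i)" "finite F" "\<And>i. i \<in> I \<Longrightarrow> i \<notin> F \<Longrightarrow> f i \<in> B i"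
  shows "(\<lambda>i\<in>I. f i) \<in> carrier A"
  unfolding A_iff
proof
  show "finite {i\<in>I. (\<lambda>i\<in>I. f i) i \<notin> B i}"
    by (rule finite_subset[OF _ assms(2)]) (use assms(3) in auto)
qed (use assms(1) in auto)

lemma A_zero_closed: "\<zero>\<^bsub>A\<^esub> \<in> carrier A"
  unfolding A_simps by (rule A_memI[of _ "{}"]) (use B_zero B_carrier in auto)

lemma A_one_closed: "\<one>\<^bsub>A\<^esub> \<in> carrier A"
  unfolding A_simps by (rule A_memI[of _ "{}"]) (use B_one B_carrier in auto)

lemma A_binop_closed:
  assumes "x \<in> carrier A" "y \<in> carrier A"
    and "\<And>i a b. i \<in> I \<Longrightarrow> a \<in> carrier (R i) \<Longrightarrow> b \<in> carrier (R i) \<Longrightarrow> f i a b \<in> carrier (R i)"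
    and "\<And>i a b. i \<in> I \<Longrightarrow> a \<in> B i \<Longrightarrow> b \<in> B i \<Longrightarrow> f i a b \<in> B i"
  shows "(\<lambda>i\<in>I. f i (x i) (y i)) \<in> carrier A"
  by (rule A_memI[of _ "{i\<in>I. x i \<notin> B i} \<union> {i\<in>I. y i \<notin> B i}"])
    (use assms A_component in \<open>auto simp: A_iff\<close>)

lemma A_add_closed: "x \<in> carrier A \<Longrightarrow> y \<in> carrier A \<Longrightarrow> x \<oplus>\<^bsub>A\<^esub> y \<in> carrier A"
  unfolding A_simps by (rule A_binop_closed) (auto simp: B_add ring.ring_simprules ring)

lemma A_mult_closed: "x \<in> carrier A \<Longrightarrow> y \<in> carrier A \<Longrightarrow> x \<otimes>\<^bsub>A\<^esub> y \<in> carrier A"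
  unfolding A_simps by (rule A_binop_closed) (auto simp: B_mult ring.ring_simprules ring)

lemma A_minus_component_closed: "x \<in> carrier A \<Longrightarrow> (\<lambda>i\<in>I. \<ominus>\<^bsub>R i\<^esub> x i) \<in> carrier A"
  by (rule A_binop_closed[of x x "\<lambda>i x y. \<ominus>\<^bsub>R i\<^esub> x"])
    (auto simp: B_minus ring.ring_simprules ring)

lemma abelian_group_A: "abelian_group A"
proof (rule abelian_groupI)
  fix x y z assume xyz: "x \<in> carrier A" "y \<in> carrier A" "z \<in> carrier A"
  show "x \<oplus>\<^bsub>A\<^esub> y \<oplus>\<^bsub>A\<^esub> z = x \<oplus>\<^bsub>A\<^esub> (y \<oplus>\<^bsub>A\<^esub> z)"
    using xyz by (auto simp: A_simps ring.ring_simprules ring A_component)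
next
  fix x y assume xy: "x \<in> carrier A" "y \<in> carrier A"
  show "x \<oplus>\<^bsub>A\<^esub> y = y \<oplus>\<^bsub>A\<^esub> x"
    unfolding A_simps
    by (rule restrict_ext) (metis A_component xy ring ring.ring_simprules(10))
next
  fix x assume x: "x \<in> carrier A"
  show "\<zero>\<^bsub>A\<^esub> \<oplus>\<^bsub>A\<^esub> x = x"
    by (rule A_eqI)
      (auto simp: A_add_closed A_zero_closed x, auto simp: A_simps ring.ring_simprules ring A_component x)
  have "(\<lambda>i\<in>I. \<ominus>\<^bsub>R i\<^esub> x i) \<oplus>\<^bsub>A\<^esub> x = \<zero>\<^bsub>A\<^esub>"
    by (auto simp: A_simps ring.ring_simprules ring A_component x)
  then show "\<exists>y\<in>carrier A. y \<oplus>\<^bsub>A\<^esub> x = \<zero>\<^bsub>A\<^esub>"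
    using A_minus_component_closed[OF x] by blast
qed (auto simp: A_zero_closed A_add_closed)

lemma A_minus: assumes "x \<in> carrier A" shows "\<ominus>\<^bsub>A\<^esub> x = (\<lambda>i\<in>I. \<ominus>\<^bsub>R i\<^esub> x i)"
proof (rule abelian_group.minus_equality[OF abelian_group_A])
  show "(\<lambda>i\<in>I. \<ominus>\<^bsub>R i\<^esub> x i) \<oplus>\<^bsub>A\<^esub> x = \<zero>\<^bsub>A\<^esub>"
    by (auto simp: A_simps ring.ring_simprules ring A_component assms)
qed (use assms A_minus_component_closed in auto)

lemma eval_term_A:
  assumes "has_sort ring_language t ()" "\<And>x. x \<in> term_vars t \<Longrightarrow> \<alpha> x \<in> carrier A"
  shows "eval_term (ring_structure A) \<alpha> t \<in> carrier A \<and>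
    (\<forall>v\<in>I. eval_term (ring_structure A) \<alpha> t v = eval_term (ring_structure (R v)) (\<lambda>x. \<alpha> x v) t)"
  using assms
proof (induction rule: ring_term_induct)
  case (RNeg t)
  then show ?case
    using A_minus_component_closed by (simp add: A_minus del: restrict_apply) (simp add: restrict_def)
qed (auto simp: A_zero_closed A_one_closed A_add_closed A_mult_closed, auto simp: A_simps)

section \<open>The Feferman-Vaught induction\<close>

definition pattern ::
  "(unit, ring_symbol, unit) fo_form set \<Rightarrow> (unit \<times> nat \<Rightarrow> 'i \<Rightarrow> 'a) \<Rightarrow> 'i \<Rightarrow>
   (unit, ring_symbol, unit) fo_form set" where
  "pattern F \<alpha> v = {\<phi>\<in>F. sat (ring_structure (R v)) (\<lambda>x. \<alpha> x v) \<phi>}"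

lemma same_counts_pattern_mono:
  assumes "same_counts J I (pattern G \<alpha>) (pattern G \<alpha>')" "finite G" "F \<subseteq> G" "j \<le> J"
  shows "same_counts j I (pattern F \<alpha>) (pattern F \<alpha>')"
proof -
  have "same_counts j I (\<lambda>v. pattern G \<alpha> v \<inter> F) (\<lambda>v. pattern G \<alpha>' v \<inter> F)"
    by (rule same_counts_map[OF same_counts_antimono[OF assms(1,4)], where T = "Pow G"])
      (auto simp: pattern_def assms(2))
  moreover have "(\<lambda>v. pattern G \<beta> v \<inter> F) = pattern F \<beta>" for \<beta>
    using assms(3) by (auto simp: pattern_def fun_eq_iff)
  ultimately show ?thesis
    by simp
qed

text \<open>One implication suffices, since \<open>same_counts\<close> is symmetric;
  \<open>determines_iff\<close> draws this conclusion. The local formulas may use only the free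
  variables of \<open>\<Phi>\<close>, so that they can later define sets of
  \<open>m\<close>-tuples.\<close>

definition determines ::
  "(unit, ring_symbol, unit) fo_form set \<Rightarrow> nat \<Rightarrow> (unit, ring_symbol, unit) fo_form \<Rightarrow> bool" where
  "determines F J \<Phi> \<longleftrightarrow> finite F \<and> 1 \<le> J \<and>
     (\<forall>\<phi>\<in>F. formula ring_language \<phi> \<and> free_vars \<phi> \<subseteq> free_vars \<Phi>) \<and>
     (\<forall>\<alpha> \<alpha>'. (\<forall>x\<in>free_vars \<Phi>. \<alpha> x \<in> carrier A \<and> \<alpha>' x \<in> carrier A) \<longrightarrow>
        same_counts J I (pattern F \<alpha>) (pattern F \<alpha>') \<longrightarrow>
        sat (ring_structure A) \<alpha> \<Phi> \<longrightarrow> sat (ring_structure A) \<alpha>' \<Phi>)"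

lemma determines_iff:
  assumes "determines F J \<Phi>" "\<And>x. x \<in> free_vars \<Phi> \<Longrightarrow> \<alpha> x \<in> carrier A"
    "\<And>x. x \<in> free_vars \<Phi> \<Longrightarrow> \<alpha>' x \<in> carrier A" "same_counts J I (pattern F \<alpha>) (pattern F \<alpha>')"
  shows "sat (ring_structure A) \<alpha> \<Phi> \<longleftrightarrow> sat (ring_structure A) \<alpha>' \<Phi>"
  using assms same_counts_sym unfolding determines_def by blast

text \<open>Equality in the product means that no index has the empty pattern, and the cut-off 1
  decides emptiness.\<close>

lemma determines_Eq:
  assumes "formula ring_language (Eq t u)"
  shows "determines {Eq t u} 1 (Eq t u)"
  unfolding determines_def
proof (intro conjI allI impI ballI)
  fix \<alpha> \<alpha>' :: "unit \<times> nat \<Rightarrow> 'i \<Rightarrow> 'a"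
  assume vars: "\<forall>x\<in>free_vars (Eq t u). \<alpha> x \<in> carrier A \<and> \<alpha>' x \<in> carrier A"
    and same: "same_counts 1 I (pattern {Eq t u} \<alpha>) (pattern {Eq t u} \<alpha>')"
    and sat: "sat (ring_structure A) \<alpha> (Eq t u)"
  have sorts: "has_sort ring_language t ()" "has_sort ring_language u ()"
    using assms by auto
  have \<alpha>: "Eq t u \<in> pattern {Eq t u} \<alpha> v" if "v \<in> I" for v
    using sat eval_term_A[OF sorts(1), of \<alpha>] eval_term_A[OF sorts(2), of \<alpha>] vars that
    by (auto simp: pattern_def)
  have "Eq t u \<in> pattern {Eq t u} \<alpha>' v" if "v \<in> I" for v
    using same_counts_nonempty[OF same _ that] \<alpha> by (metis order_refl)
  then have "eval_term (ring_structure A) \<alpha>' t = eval_term (ring_structure A) \<alpha>' u"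
    using eval_term_A[OF sorts(1), of \<alpha>'] eval_term_A[OF sorts(2), of \<alpha>'] vars
    by (intro A_eqI) (auto simp: pattern_def)
  then show "sat (ring_structure A) \<alpha>' (Eq t u)"
    by simp
qed (use assms in auto)

lemma determines_Neg: "determines F J \<Phi> \<Longrightarrow> determines F J (Neg \<Phi>)"
  unfolding determines_def using same_counts_sym by (simp, blast)

lemma determines_Conj:
  assumes "determines F J \<Phi>" "determines G K \<Psi>"
  shows "determines (F \<union> G) (max J K) (Conj \<Phi> \<Psi>)"
  unfolding determines_def
proof (intro conjI allI impI ballI)
  fix \<alpha> \<alpha>' :: "unit \<times> nat \<Rightarrow> 'i \<Rightarrow> 'a"
  assume vars: "\<forall>x\<in>free_vars (Conj \<Phi> \<Psi>). \<alpha> x \<in> carrier A \<and> \<alpha>' x \<in> carrier A"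
    and same: "same_counts (max J K) I (pattern (F \<union> G) \<alpha>) (pattern (F \<union> G) \<alpha>')"
    and sat: "sat (ring_structure A) \<alpha> (Conj \<Phi> \<Psi>)"
  have "finite (F \<union> G)"
    using assms by (simp add: determines_def)
  note mono = same_counts_pattern_mono[OF same this]
  have "sat (ring_structure A) \<alpha>' \<Phi>"
    using determines_iff[OF assms(1) _ _ mono] vars sat by auto
  moreover have "sat (ring_structure A) \<alpha>' \<Psi>"
    using determines_iff[OF assms(2) _ _ mono] vars sat by auto
  ultimately show "sat (ring_structure A) \<alpha>' (Conj \<Phi> \<Psi>)"
    by simp
qed (use assms in \<open>auto simp: determines_def\<close>)

text \<open>The new local formulas say, for each \<open>S \<subseteq> G\<close>, that some element
  realises exactly the pattern \<open>S\<close> over \<open>G\<close>. A witness \<open>y\<close>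
  colours the indices by its \<open>G\<close>-pattern; \<open>same_counts_extend\<close> transports
  the colouring to \<open>\<alpha>'\<close>, and a new witness is chosen index by index.\<close>

lemma determines_Exists:
  assumes "determines F J \<Phi>"
  shows "\<exists>F' J'. determines F' J' (Exists x \<Phi>)"
proof -
  \<comment> \<open>\<open>\<theta>\<close> makes integrality of the witness part of its
    pattern.\<close>
  define G where "G = insert (\<theta> (snd x)) F"
  have F: "finite F" "1 \<le> J" "\<And>\<phi>. \<phi> \<in> F \<Longrightarrow> formula ring_language \<phi>"
    "\<And>\<phi>. \<phi> \<in> F \<Longrightarrow> free_vars \<phi> \<subseteq> free_vars \<Phi>"
    using assms by (auto simp: determines_def)
  have x: "x = ((), snd x)"
    by (cases x) simp
  have G: "finite G" "\<And>\<phi>. \<phi> \<in> G \<Longrightarrow> formula ring_language \<phi>"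
    "\<Union> (free_vars ` G) \<subseteq> insert x (free_vars \<Phi>)"
  proof -
    have "free_vars (\<theta> (snd x)) \<subseteq> {x}"
      using free_vars_\<theta>[of "snd x"] x by simp
    then show "\<Union> (free_vars ` G) \<subseteq> insert x (free_vars \<Phi>)"
      using F(4) unfolding G_def by blast
  qed (use F(1,3) formula_\<theta> in \<open>auto simp: G_def\<close>)
  define \<chi> where "\<chi> S = (SOME \<chi>. formula ring_language \<chi> \<and> free_vars \<chi> \<subseteq> \<Union> (free_vars ` G) \<and>
    (\<forall>(M :: (unit, ring_symbol, unit, 'a) fo_structure) \<alpha>.
       sat M \<alpha> \<chi> \<longleftrightarrow> {\<phi>\<in>G. sat M \<alpha> \<phi>} = S \<inter> G))" for S
  have "formula ring_language (\<chi> S) \<and> free_vars (\<chi> S) \<subseteq> \<Union> (free_vars ` G) \<and>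
    (\<forall>(M :: (unit, ring_symbol, unit, 'a) fo_structure) \<alpha>.
       sat M \<alpha> (\<chi> S) \<longleftrightarrow> {\<phi>\<in>G. sat M \<alpha> \<phi>} = S \<inter> G)" for S
    unfolding \<chi>_def by (rule someI_ex) (rule ex_pattern_formula[OF G(1,2)])
  then have \<chi>: "formula ring_language (\<chi> S)" "free_vars (\<chi> S) \<subseteq> \<Union> (free_vars ` G)"
    "sat M \<alpha> (\<chi> S) \<longleftrightarrow> {\<phi>\<in>G. sat M \<alpha> \<phi>} = S \<inter> G"
    for S \<alpha> and M :: "(unit, ring_symbol, unit, 'a) fo_structure"
    by blast+
  define F' where "F' = (\<lambda>S. Exists x (\<chi> S)) ` Pow G"
  \<comment> \<open>\<open>Pow G\<close> is the set of colours of the witness;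
    \<open>same_counts_extend\<close> costs the factor \<open>2 ^ card (Pow G)\<close>.\<close>
  define J' where "J' = 2 ^ card (Pow G) * J"
  have upd: "(\<lambda>z. (\<alpha>(x := y)) z v) = (\<lambda>z. \<alpha> z v)(x := y v)" for \<alpha> :: "unit \<times> nat \<Rightarrow> 'i \<Rightarrow> 'a" and y v
    by auto
  have pattern_upd: "pattern F (\<alpha>(x := y)) v =
      {\<phi>\<in>F. sat (ring_structure (R v)) ((\<lambda>z. \<alpha> z v)(x := y v)) \<phi>}" for F \<alpha> y v
    unfolding pattern_def upd ..
  have "determines F' J' (Exists x \<Phi>)"
    unfolding determines_def
  proof (intro conjI allI impI)
    fix \<alpha> \<alpha>' :: "unit \<times> nat \<Rightarrow> 'i \<Rightarrow> 'a"
    assume vars: "\<forall>z\<in>free_vars (Exists x \<Phi>). \<alpha> z \<in> carrier A \<and> \<alpha>' z \<in> carrier A"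
      and same: "same_counts J' I (pattern F' \<alpha>) (pattern F' \<alpha>')"
      and sat: "sat (ring_structure A) \<alpha> (Exists x \<Phi>)"
    then obtain y where y: "y \<in> carrier A" "sat (ring_structure A) (\<alpha>(x := y)) \<Phi>"
      by auto
    define f where "f = pattern G (\<alpha>(x := y))"
    have "f ` I \<subseteq> Pow G"
      by (auto simp: f_def pattern_def)
    then obtain f' where f': "same_counts J I (\<lambda>v. (pattern F' \<alpha> v, f v)) (\<lambda>v. (pattern F' \<alpha>' v, f' v))"
      using same_counts_extend[of "Pow G" J f I "pattern F' \<alpha>" "pattern F' \<alpha>'"] same G(1) F(2)
      unfolding J'_def by auto
    \<comment> \<open>At \<open>v\<close> the pattern \<open>f' v\<close> is realisable because some
      \<open>w\<close> has the same colours: there \<open>y w\<close> realises it, so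
      \<open>Exists x (\<chi> (f' v))\<close> holds at \<open>w\<close> and, as the
      \<open>F'\<close>-patterns agree, at \<open>v\<close>.\<close>
    have ex: "\<exists>b\<in>carrier (R v).
        {\<phi>\<in>G. sat (ring_structure (R v)) ((\<lambda>z. \<alpha>' z v)(x := b)) \<phi>} = f' v" and sub: "f' v \<subseteq> G"
      if v: "v \<in> I" for v
    proof -
      obtain w where w: "w \<in> I" "pattern F' \<alpha> w = pattern F' \<alpha>' v" "f w = f' v"
        using same_counts_nonempty[OF f' F(2) v] by (metis Pair_inject)
      show sub: "f' v \<subseteq> G"
        using w(3) by (auto simp: f_def pattern_def)
      have "sat (ring_structure (R w)) (\<lambda>z. \<alpha> z w) (Exists x (\<chi> (f' v)))"
      proof -
        have "sat (ring_structure (R w)) ((\<lambda>z. \<alpha> z w)(x := y w)) (\<chi> (f' v))"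
          unfolding \<chi>(3) using sub w(3) unfolding f_def pattern_upd by blast
        then show ?thesis
          unfolding sat.simps ring_structure_simps using A_component[OF y(1) w(1)] by blast
      qed
      then have "Exists x (\<chi> (f' v)) \<in> pattern F' \<alpha> w"
        using sub by (auto simp: pattern_def F'_def)
      then have "sat (ring_structure (R v)) (\<lambda>z. \<alpha>' z v) (Exists x (\<chi> (f' v)))"
        by (simp only: w(2)) (simp only: pattern_def mem_Collect_eq)
      then show "\<exists>b\<in>carrier (R v).
          {\<phi>\<in>G. sat (ring_structure (R v)) ((\<lambda>z. \<alpha>' z v)(x := b)) \<phi>} = f' v"
        unfolding sat.simps ring_structure_simps \<chi>(3) using sub by (simp add: Int_absorb2 del: fun_upd_apply)
    qed
    then have "\<forall>v\<in>I. \<exists>b. b \<in> carrier (R v) \<and>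
        {\<phi>\<in>G. sat (ring_structure (R v)) ((\<lambda>z. \<alpha>' z v)(x := b)) \<phi>} = f' v"
      by blast
    then have "\<exists>b. \<forall>v\<in>I. b v \<in> carrier (R v) \<and>
        {\<phi>\<in>G. sat (ring_structure (R v)) ((\<lambda>z. \<alpha>' z v)(x := b v)) \<phi>} = f' v"
      by (rule bchoice)
    then obtain b where b: "\<And>v. v \<in> I \<Longrightarrow> b v \<in> carrier (R v)"
      "\<And>v. v \<in> I \<Longrightarrow> {\<phi>\<in>G. sat (ring_structure (R v)) ((\<lambda>z. \<alpha>' z v)(x := b v)) \<phi>} = f' v"
      by blast
    define y' where "y' = (\<lambda>v\<in>I. b v)"
    have pat: "pattern G (\<alpha>'(x := y')) v = f' v" if "v \<in> I" for v
      using b(2)[OF that] that unfolding pattern_upd y'_def by (simp del: fun_upd_apply)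
    have \<theta>_iff: "\<theta> (snd x) \<in> pattern G (\<beta>(x := z)) v \<longleftrightarrow> z v \<in> B v"
      if "v \<in> I" "z v \<in> carrier (R v)" for \<beta> :: "unit \<times> nat \<Rightarrow> 'i \<Rightarrow> 'a" and z v
    proof -
      have "((\<lambda>u. \<beta> u v)(x := z v)) ((), snd x) = z v"
        using x by simp
      then show ?thesis
        using sat_\<theta>[OF that(1), of "(\<lambda>u. \<beta> u v)(x := z v)" "snd x"] that(2)
        unfolding pattern_upd G_def by simp
    qed
    have T: "(\<lambda>v. (pattern F' \<alpha> v, f v)) ` I \<subseteq> Pow F' \<times> Pow G"
      "(\<lambda>v. (pattern F' \<alpha>' v, f' v)) ` I \<subseteq> Pow F' \<times> Pow G"
      using sub by (auto simp: f_def pattern_def)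
    have finT: "finite (Pow F' \<times> Pow G)"
      using G(1) by (simp add: F'_def)
    \<comment> \<open>Finiteness of the set of indices where \<open>\<theta>\<close> fails passes
      from \<open>y\<close> to \<open>y'\<close>, since the counts record infinity.\<close>
    have "same_counts J I (\<lambda>v. \<theta> (snd x) \<in> f v) (\<lambda>v. \<theta> (snd x) \<in> f' v)"
      using same_counts_map[OF f' finT T, of "\<lambda>(P, S). \<theta> (snd x) \<in> S"] by simp
    then have trunc: "trunc_card J {v\<in>I. (\<theta> (snd x) \<in> f v) = False} = trunc_card J {v\<in>I. (\<theta> (snd x) \<in> f' v) = False}"
      unfolding same_counts_def by blast
    have B: "{v\<in>I. (\<theta> (snd x) \<in> f v) = False} = {v\<in>I. y v \<notin> B v}"
      using \<theta>_iff A_component[OF y(1)] by (auto simp: f_def)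
    have B': "{v\<in>I. (\<theta> (snd x) \<in> f' v) = False} = {v\<in>I. y' v \<notin> B v}"
      using \<theta>_iff[of _ y' \<alpha>'] b(1) pat by (auto simp: y'_def)
    have "finite {v\<in>I. y v \<notin> B v}"
      using y(1) by (simp add: A_iff)
    then have "finite {v\<in>I. y' v \<notin> B v}"
      using trunc trunc_card_eq_None_iff[of J "{v\<in>I. y v \<notin> B v}"]
        trunc_card_eq_None_iff[of J "{v\<in>I. y' v \<notin> B v}"] unfolding B B' by simp
    then have y': "y' \<in> carrier A"
      using b(1) by (auto simp: A_iff y'_def)
    have f_F: "f v \<inter> F = pattern F (\<alpha>(x := y)) v" for v
      unfolding f_def pattern_def G_def by blast
    have f'_F: "f' v \<inter> F = pattern F (\<alpha>'(x := y')) v" if "v \<in> I" for v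
      unfolding pat[OF that, symmetric] unfolding pattern_def G_def by blast
    have "same_counts J I (\<lambda>v. f v \<inter> F) (\<lambda>v. f' v \<inter> F)"
      using same_counts_map[OF f' finT T, of "\<lambda>(P, S). S \<inter> F"] by simp
    then have "same_counts J I (pattern F (\<alpha>(x := y))) (pattern F (\<alpha>'(x := y')))"
      by (simp add: same_counts_def f_F f'_F cong: conj_cong)
    then have "sat (ring_structure A) (\<alpha>(x := y)) \<Phi> \<longleftrightarrow> sat (ring_structure A) (\<alpha>'(x := y')) \<Phi>"
      by (rule determines_iff[OF assms, rotated 2]) (use vars y(1) y' in auto)
    then show "sat (ring_structure A) \<alpha>' (Exists x \<Phi>)"
      using y(2) y' by auto
  next
    show "\<forall>\<phi>\<in>F'. formula ring_language \<phi> \<and> free_vars \<phi> \<subseteq> free_vars (Exists x \<Phi>)"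
      using \<chi>(1,2) G(3) by (auto simp: F'_def) blast
  qed (use G(1) F(2) in \<open>auto simp: F'_def J'_def\<close>)
  then show ?thesis
    by blast
qed

theorem ex_determines: "formula ring_language \<Phi> \<Longrightarrow> \<exists>F J. determines F J \<Phi>"
proof (induction \<Phi>)
  case (Eq t u)
  then show ?case
    using determines_Eq by blast
next
  case (Neg \<Phi>)
  then show ?case
    using determines_Neg by fastforce
next
  case (Conj \<Phi> \<Psi>)
  then show ?case
    using determines_Conj by fastforce
next
  case (Exists x \<Phi>)
  then show ?case
    using determines_Exists by fastforce
qed simp

end

section \<open>Defining the valuation ring\<close>

text \<open>In the completions the derivative \<open>2 * y + 1\<close> of the left-hand side is a
  unit at every \<open>y\<close> of value below 1, also in residue characteristic 2, where square
  roots would cause trouble.\<close>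

definition artin_schreier_set :: "'a ring \<Rightarrow> 'a \<Rightarrow> 'a set" where
  "artin_schreier_set R b =
     {x \<in> carrier R. \<exists>y\<in>carrier R. y \<otimes>\<^bsub>R\<^esub> y \<oplus>\<^bsub>R\<^esub> y = b \<otimes>\<^bsub>R\<^esub> (x \<otimes>\<^bsub>R\<^esub> x)}"

text \<open>The single closure condition yields sums by \<open>z = 1\<close> and, once 0 is known to
  lie in \<open>S\<close>, products by \<open>x = 0\<close>. Negatives come for free in
  \<open>artin_schreier_set\<close>, where \<open>x\<close> enters only through its square.\<close>

definition valuation_subring :: "'a ring \<Rightarrow> 'a set \<Rightarrow> bool" where
  "valuation_subring R S \<longleftrightarrow> \<one>\<^bsub>R\<^esub> \<in> S \<and>
     (\<forall>x\<in>S. \<forall>y\<in>S. \<forall>z\<in>S. x \<oplus>\<^bsub>R\<^esub> y \<otimes>\<^bsub>R\<^esub> z \<in> S) \<and>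
     (\<forall>x\<in>carrier R. x \<in> S \<or> (\<exists>y\<in>S. x \<otimes>\<^bsub>R\<^esub> y = \<one>\<^bsub>R\<^esub>))"

definition Forall :: "'s \<times> nat \<Rightarrow> ('s, 'f, 'r) fo_form \<Rightarrow> ('s, 'f, 'r) fo_form" where
  "Forall x \<phi> = Neg (Exists x (Neg \<phi>))"

definition Imp :: "('s, 'f, 'r) fo_form \<Rightarrow> ('s, 'f, 'r) fo_form \<Rightarrow> ('s, 'f, 'r) fo_form" where
  "Imp \<phi> \<psi> = Neg (Conj \<phi> (Neg \<psi>))"

lemma sat_Forall [simp]: "sat M \<alpha> (Forall x \<phi>) \<longleftrightarrow> (\<forall>a\<in>univ M (fst x). sat M (\<alpha>(x := a)) \<phi>)"
  and sat_Imp [simp]: "sat M \<alpha> (Imp \<phi> \<psi>) \<longleftrightarrow> (sat M \<alpha> \<phi> \<longrightarrow> sat M \<alpha> \<psi>)"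
  and formula_Forall [simp]: "formula L (Forall x \<phi>) \<longleftrightarrow> fst x \<in> sorts L \<and> formula L \<phi>"
  and formula_Imp [simp]: "formula L (Imp \<phi> \<psi>) \<longleftrightarrow> formula L \<phi> \<and> formula L \<psi>"
  and free_vars_Forall [simp]: "free_vars (Forall x \<phi>) = free_vars \<phi> - {x}"
  and free_vars_Imp [simp]: "free_vars (Imp \<phi> \<psi>) = free_vars \<phi> \<union> free_vars \<psi>"
  by (simp_all add: Forall_def Imp_def)

definition artin_schreier_form ::
  "nat \<Rightarrow> (unit, ring_symbol) fo_term \<Rightarrow> (unit, ring_symbol) fo_term \<Rightarrow>
   (unit, ring_symbol, unit) fo_form" where
  "artin_schreier_form w b t =
     Exists ((), w) (Eq (App RAdd [App RMult [Var ((), w), Var ((), w)], Var ((), w)])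
       (App RMult [b, App RMult [t, t]]))"

text \<open>Bound variables are numbered above \<open>n\<close>: \<open>n + 1\<close> for the
  parameter, \<open>n + 2\<close> to \<open>n + 4\<close> for ring elements and \<open>n + 5\<close>
  for the Artin-Schreier witness, so no capture occurs.\<close>

definition integer_form :: "nat \<Rightarrow> (unit, ring_symbol, unit) fo_form" where
  "integer_form n =
     (let b = Var ((), n + 1); x = Var ((), n + 2); y = Var ((), n + 3); z = Var ((), n + 4);
          S = artin_schreier_form (n + 5) b
      in Forall ((), n + 1)
        (Imp
          (Conj (S (App ROne []))
          (Conj (Forall ((), n + 2) (Forall ((), n + 3) (Forall ((), n + 4)
                  (Imp (Conj (S x) (Conj (S y) (S z))) (S (App RAdd [x, App RMult [y, z]]))))))
                (Forall ((), n + 2) (Imp (Neg (S x))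
                  (Exists ((), n + 3) (Conj (Eq (App RMult [x, y]) (App ROne [])) (S y)))))))
          (S (Var ((), n)))))"

lemma formula_integer_form: "formula ring_language (integer_form n)"
  by (simp add: integer_form_def artin_schreier_form_def Let_def)

lemma free_vars_integer_form: "free_vars (integer_form n) \<subseteq> {((), n)}"
  by (auto simp: integer_form_def artin_schreier_form_def Let_def)

lemma eval_term_upd [simp]: "x \<notin> term_vars t \<Longrightarrow> eval_term M (\<alpha>(x := a)) t = eval_term M \<alpha> t"
  by (induction t) (auto cong: map_cong)

lemma sat_artin_schreier_form:
  assumes "((), w) \<notin> term_vars b \<union> term_vars t"
    and "eval_term (ring_structure R) \<alpha> t \<in> carrier R"
  shows "sat (ring_structure R) \<alpha> (artin_schreier_form w b t) \<longleftrightarrow>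
    eval_term (ring_structure R) \<alpha> t \<in> artin_schreier_set R (eval_term (ring_structure R) \<alpha> b)"
  using assms by (simp add: artin_schreier_form_def artin_schreier_set_def)

lemma artin_schreier_set_subset: "artin_schreier_set R b \<subseteq> carrier R"
  by (auto simp: artin_schreier_set_def)

lemma valuation_subring_altdef:
  assumes "S \<subseteq> carrier R"
  shows "valuation_subring R S \<longleftrightarrow> \<one>\<^bsub>R\<^esub> \<in> S \<and>
     (\<forall>x\<in>carrier R. \<forall>y\<in>carrier R. \<forall>z\<in>carrier R.
        x \<in> S \<and> y \<in> S \<and> z \<in> S \<longrightarrow> x \<oplus>\<^bsub>R\<^esub> y \<otimes>\<^bsub>R\<^esub> z \<in> S) \<and>
     (\<forall>x\<in>carrier R. x \<notin> S \<longrightarrow> (\<exists>y\<in>carrier R. x \<otimes>\<^bsub>R\<^esub> y = \<one>\<^bsub>R\<^esub> \<and> y \<in> S))"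
  unfolding valuation_subring_def using assms by blast

lemma sat_integer_form:
  assumes "ring R" "\<alpha> ((), n) \<in> carrier R"
  shows "sat (ring_structure R) \<alpha> (integer_form n) \<longleftrightarrow>
    (\<forall>b\<in>carrier R. valuation_subring R (artin_schreier_set R b) \<longrightarrow>
       \<alpha> ((), n) \<in> artin_schreier_set R b)"
  using assms
  by (simp add: integer_form_def Let_def valuation_subring_altdef[OF artin_schreier_set_subset]
      sat_artin_schreier_form ring.ring_simprules)

section \<open>The completion as Cauchy sequences modulo null sequences\<close>

lemma (in nonarch_field) cring_cauchy_ring: "cring (cauchy_ring a)"
proof (rule cringI)
  show "abelian_group (cauchy_ring a)"
  proof (rule abelian_groupI)
    fix f assume "f \<in> C"
    then show "\<exists>g\<in>C. g \<oplus>\<^bsub>cauchy_ring a\<^esub> f = \<zero>\<^bsub>cauchy_ring a\<^esub>"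
      by (intro bexI[OF _ C_minus]) (simp_all add: cauchy_ring_def)
  qed (use C_add C_const in \<open>simp_all add: cauchy_ring_def algebra_simps\<close>)
  show "comm_monoid (cauchy_ring a)"
    by (rule comm_monoidI) (use C_mult C_const in \<open>simp_all add: cauchy_ring_def algebra_simps\<close>)
qed (simp add: cauchy_ring_def algebra_simps)

lemma (in nonarch_field) cauchy_ring_minus:
  assumes "f \<in> C" shows "\<ominus>\<^bsub>cauchy_ring a\<^esub> f = (\<lambda>i. - f i)"
proof -
  interpret cring "cauchy_ring a"
    by (rule cring_cauchy_ring)
  show ?thesis
    by (rule minus_equality) (use C_minus[OF assms] assms in \<open>simp_all add: cauchy_ring_def\<close>)
qed

lemma (in nonarch_field) ideal_null_sequences: "ideal Z (cauchy_ring a)"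
proof (rule idealI)
  show "ring (cauchy_ring a)"
    using cring_cauchy_ring by (rule cring.axioms)
  then interpret ring "cauchy_ring a" .
  show "subgroup Z (add_monoid (cauchy_ring a))"
  proof (rule add.subgroupI)
    show "Z \<subseteq> C"
      using Z_imp_C by blast
    show "Z \<noteq> {}"
      using Z_const_iff[of 0] by blast
    show "\<ominus>\<^bsub>cauchy_ring a\<^esub> f \<in> Z" if "f \<in> Z" for f
      using that Z_minus Z_imp_C by (simp add: cauchy_ring_minus)
    show "f \<oplus>\<^bsub>cauchy_ring a\<^esub> g \<in> Z" if "f \<in> Z" "g \<in> Z" for f g
      using Z_add[OF that] by (simp add: cauchy_ring_def)
  qed
qed (use C_mult_Z Z_mult_C in \<open>simp_all add: cauchy_ring_def\<close>)

context nonarch_field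
begin

definition K where "K = cauchy_ring a Quot Z"

definition cls where "cls f = Z +>\<^bsub>cauchy_ring a\<^esub> f"

lemma cring_K: "cring K"
  unfolding K_def using ideal.quotient_is_cring[OF ideal_null_sequences cring_cauchy_ring] .

lemma carrier_K: "carrier K = cls ` C"
  by (auto simp: K_def FactRing_def A_RCOSETS_def' cls_def)

lemma cls_hom: "ring_hom_ring (cauchy_ring a) K cls"
proof -
  have "cls = (+>\<^bsub>cauchy_ring a\<^esub>) Z"
    by (simp add: cls_def fun_eq_iff)
  then show ?thesis
    unfolding K_def using ideal.rcos_ring_hom_ring[OF ideal_null_sequences] by simp
qed

lemma cls_closed [simp]: "f \<in> C \<Longrightarrow> cls f \<in> carrier K"
  by (simp add: carrier_K)

lemma K_add: "f \<in> C \<Longrightarrow> g \<in> C \<Longrightarrow> cls f \<oplus>\<^bsub>K\<^esub> cls g = cls (\<lambda>i. f i + g i)"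
  and K_mult: "f \<in> C \<Longrightarrow> g \<in> C \<Longrightarrow> cls f \<otimes>\<^bsub>K\<^esub> cls g = cls (\<lambda>i. f i * g i)"
  and K_minus: "f \<in> C \<Longrightarrow> \<ominus>\<^bsub>K\<^esub> cls f = cls (\<lambda>i. - f i)"
  and K_zero: "\<zero>\<^bsub>K\<^esub> = cls (\<lambda>_. 0)"
  and K_one: "\<one>\<^bsub>K\<^esub> = cls (\<lambda>_. 1)"
proof -
  interpret ring_hom_ring "cauchy_ring a" K cls
    by (rule cls_hom)
  show "f \<in> C \<Longrightarrow> g \<in> C \<Longrightarrow> cls f \<oplus>\<^bsub>K\<^esub> cls g = cls (\<lambda>i. f i + g i)"
    using hom_add[of f g] by (simp add: cauchy_ring_def)
  show "f \<in> C \<Longrightarrow> g \<in> C \<Longrightarrow> cls f \<otimes>\<^bsub>K\<^esub> cls g = cls (\<lambda>i. f i * g i)"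
    using hom_mult[of f g] by (simp add: cauchy_ring_def)
  show "f \<in> C \<Longrightarrow> \<ominus>\<^bsub>K\<^esub> cls f = cls (\<lambda>i. - f i)"
    using hom_a_inv[of f] by (simp add: cauchy_ring_minus)
  show "\<zero>\<^bsub>K\<^esub> = cls (\<lambda>_. 0)"
    using hom_zero by (simp add: cauchy_ring_def)
  show "\<one>\<^bsub>K\<^esub> = cls (\<lambda>_. 1)"
    using hom_one by (simp add: cauchy_ring_def)
qed

lemma cls_eq_iff:
  assumes "f \<in> C" "g \<in> C"
  shows "cls f = cls g \<longleftrightarrow> (\<lambda>i. f i - g i) \<in> Z"
proof -
  interpret cring "cauchy_ring a"
    by (rule cring_cauchy_ring)
  have "f \<ominus>\<^bsub>cauchy_ring a\<^esub> g = (\<lambda>i. f i - g i)"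
    unfolding a_minus_def cauchy_ring_minus[OF assms(2)] by (simp add: cauchy_ring_def)
  then show ?thesis
    using quotient_eq_iff_same_a_r_cos[OF ideal_null_sequences assms] by (simp add: cls_def)
qed

lemma mem_cls_iff: "f \<in> C \<Longrightarrow> g \<in> cls f \<longleftrightarrow> (\<lambda>i. g i - f i) \<in> Z"
proof -
  have "(\<exists>h\<in>Z. g = (\<lambda>i. h i + f i)) \<longleftrightarrow> (\<lambda>i. g i - f i) \<in> Z"
    by (auto intro!: bexI[of _ "\<lambda>i. g i - f i"])
  then show ?thesis
    by (simp add: cls_def a_r_coset_def' cauchy_ring_def)
qed

text \<open>Representatives differ by null sequences, so their values have the same limit, which
  makes the description well-defined. Outside \<open>Z\<close> the values are eventually constant,
  and the limit is at most 1 exactly when they eventually are; inside \<open>Z\<close> both sides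
  hold.\<close>

lemma limit_le_1_iff:
  assumes "f \<in> C"
  shows "(THE r. \<forall>g\<in>cls f. (\<lambda>i. a (g i)) \<longlonglongrightarrow> r) \<le> 1 \<longleftrightarrow> (\<forall>\<^sub>F i in sequentially. a (f i) \<le> 1)"
proof -
  obtain r where r: "(\<lambda>i. a (f i)) \<longlonglongrightarrow> r" "r \<le> 1 \<longleftrightarrow> (\<forall>\<^sub>F i in sequentially. a (f i) \<le> 1)"
  proof (cases "f \<in> Z")
    case True
    then have "\<forall>\<^sub>F i in sequentially. a (f i) \<le> 1"
      using Z_D[OF True, of 1] by (auto elim: eventually_mono)
    then show ?thesis
      using True that[of 0] by (simp add: null_sequences_def)
  next
    case False
    then obtain r where r: "\<forall>\<^sub>F i in sequentially. a (f i) = r"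
      using C_dichotomy[OF assms] by blast
    then have "(\<forall>\<^sub>F i in sequentially. a (f i) \<le> 1) \<longleftrightarrow> (\<forall>\<^sub>F i :: nat in sequentially. r \<le> 1)"
      by (rule eventually_cong) simp
    then show ?thesis
      using that[of r] tendsto_eventually[OF r] by simp
  qed
  have "(\<lambda>i. a (g i)) \<longlonglongrightarrow> r" if "g \<in> cls f" for g
  proof -
    have "(\<lambda>i. a (g i - f i)) \<longlonglongrightarrow> 0"
      using that assms by (simp add: mem_cls_iff null_sequences_def)
    then have "(\<lambda>i. a (g i) - a (f i)) \<longlonglongrightarrow> 0"
      by (rule tendsto_0_le[where K = 1]) (simp add: a_abs_diff)
    then show ?thesis
      using tendsto_add[OF _ r(1)] by fastforce
  qed
  moreover have "f \<in> cls f"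
    using assms Z_const_iff[of 0] by (simp add: mem_cls_iff)
  ultimately have "(THE r. \<forall>g\<in>cls f. (\<lambda>i. a (g i)) \<longlonglongrightarrow> r) = r"
    using LIMSEQ_unique r(1) by (intro the_equality) blast+
  then show ?thesis
    using r(2) by simp
qed

text \<open>Outside \<open>Z\<close> the values are eventually constant, so one of the two
  alternatives holds eventually; null sequences have values eventually below 1.\<close>

lemma eventually_le_1_iff:
  assumes "f \<in> C"
  shows "(\<forall>\<^sub>F i in sequentially. 1 < a (f i)) \<longleftrightarrow> \<not> (\<forall>\<^sub>F i in sequentially. a (f i) \<le> 1)"
proof (cases "f \<in> Z")
  case True
  then have lt: "\<forall>\<^sub>F i in sequentially. a (f i) < 1"
    by (simp add: Z_D)
  then have "\<not> (\<forall>\<^sub>F i in sequentially. 1 < a (f i))"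
    using eventually_happens'[OF sequentially_bot, OF eventually_conj[OF lt]] by force
  then show ?thesis
    using lt by (auto elim: eventually_mono)
next
  case False
  then obtain r where r: "\<forall>\<^sub>F i in sequentially. a (f i) = r"
    using C_dichotomy[OF assms] by blast
  have "(\<forall>\<^sub>F i in sequentially. a (f i) \<le> 1) \<longleftrightarrow> (\<forall>\<^sub>F i :: nat in sequentially. r \<le> 1)"
    "(\<forall>\<^sub>F i in sequentially. 1 < a (f i)) \<longleftrightarrow> (\<forall>\<^sub>F i :: nat in sequentially. 1 < r)"
    using r by (rule eventually_cong, simp)+
  then show ?thesis
    by auto
qed

text \<open>The valuation ring described by representatives, without the limit in
  \<open>completion_abs\<close>; \<open>valuation_ring_eq\<close> identifies the two.\<close>

definition integers where "integers = {cls f | f. f \<in> C \<and> (\<forall>\<^sub>F i in sequentially. a (f i) \<le> 1)}"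

lemma cls_in_integers_iff:
  assumes "f \<in> C"
  shows "cls f \<in> integers \<longleftrightarrow> (\<forall>\<^sub>F i in sequentially. a (f i) \<le> 1)"
proof
  assume "cls f \<in> integers"
  then obtain g where "g \<in> C" "cls f = cls g" "\<forall>\<^sub>F i in sequentially. a (g i) \<le> 1"
    by (auto simp: integers_def)
  then show "\<forall>\<^sub>F i in sequentially. a (f i) \<le> 1"
    using limit_le_1_iff[OF assms] limit_le_1_iff[of g] by simp
qed (use assms in \<open>auto simp: integers_def\<close>)

lemma integers_subset: "integers \<subseteq> carrier K"
  by (auto simp: integers_def)

lemma integers_zero: "\<zero>\<^bsub>K\<^esub> \<in> integers" and integers_one: "\<one>\<^bsub>K\<^esub> \<in> integers"
  by (simp_all add: K_zero K_one cls_in_integers_iff)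

lemma integers_minus: "x \<in> integers \<Longrightarrow> \<ominus>\<^bsub>K\<^esub> x \<in> integers"
proof -
  assume "x \<in> integers"
  then obtain f where "f \<in> C" "x = cls f" "\<forall>\<^sub>F i in sequentially. a (f i) \<le> 1"
    by (auto simp: integers_def)
  then show ?thesis
    by (simp add: K_minus cls_in_integers_iff C_minus)
qed

lemma integers_add: "x \<in> integers \<Longrightarrow> y \<in> integers \<Longrightarrow> x \<oplus>\<^bsub>K\<^esub> y \<in> integers"
proof -
  assume "x \<in> integers" "y \<in> integers"
  then obtain f g where fg: "f \<in> C" "g \<in> C" "x = cls f" "y = cls g"
    and le: "\<forall>\<^sub>F i in sequentially. a (f i) \<le> 1" "\<forall>\<^sub>F i in sequentially. a (g i) \<le> 1"
    by (auto simp: integers_def)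
  from le have "\<forall>\<^sub>F i in sequentially. a (f i + g i) \<le> 1"
    by eventually_elim (meson a_ultra max.boundedI order_trans)
  then show ?thesis
    using fg by (simp add: K_add cls_in_integers_iff C_add)
qed

lemma integers_mult: "x \<in> integers \<Longrightarrow> y \<in> integers \<Longrightarrow> x \<otimes>\<^bsub>K\<^esub> y \<in> integers"
proof -
  assume "x \<in> integers" "y \<in> integers"
  then obtain f g where fg: "f \<in> C" "g \<in> C" "x = cls f" "y = cls g"
    and le: "\<forall>\<^sub>F i in sequentially. a (f i) \<le> 1" "\<forall>\<^sub>F i in sequentially. a (g i) \<le> 1"
    by (auto simp: integers_def)
  from le have "\<forall>\<^sub>F i in sequentially. a (f i * g i) \<le> 1"
    by eventually_elim (simp add: a_mult mult_le_one)
  then show ?thesis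
    using fg by (simp add: K_mult cls_in_integers_iff C_mult)
qed

lemma artin_schreier_set_K_iff:
  assumes "b \<in> C" "f \<in> C"
  shows "cls f \<in> artin_schreier_set K (cls b) \<longleftrightarrow>
    (\<exists>g\<in>C. (\<lambda>i. g i * g i + g i - b i * (f i * f i)) \<in> Z)"
  using assms by (auto simp: artin_schreier_set_def carrier_K K_add K_mult C_mult C_add cls_eq_iff)

end

section \<open>Valuation subrings given by Artin-Schreier equations\<close>

context number_field_abs
begin

lemma valuation_subring_integers: "valuation_subring K integers"
  unfolding valuation_subring_def
proof (intro conjI ballI)
  fix x assume "x \<in> carrier K"
  then obtain f where f: "f \<in> C" "x = cls f"
    by (auto simp: carrier_K)
  show "x \<in> integers \<or> (\<exists>y\<in>integers. x \<otimes>\<^bsub>K\<^esub> y = \<one>\<^bsub>K\<^esub>)"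
  proof (cases "x \<in> integers")
    case False
    then have gt: "\<forall>\<^sub>F i in sequentially. 1 < a (f i)"
      using f by (simp add: cls_in_integers_iff eventually_le_1_iff)
    have "f \<notin> Z"
    proof
      assume "f \<in> Z"
      then have "\<forall>\<^sub>F i in sequentially. a (f i) < 1"
        by (simp add: Z_D)
      with gt have "\<forall>\<^sub>F i :: nat in sequentially. False"
        by eventually_elim simp
      then show False
        by simp
    qed
    note inv = C_inverse[OF f(1) this]
    from gt have "\<forall>\<^sub>F i in sequentially. a (inverse (f i)) \<le> 1"
      by eventually_elim (simp add: a_inverse inverse_le_1_iff)
    then have "cls (\<lambda>i. inverse (f i)) \<in> integers"
      using inv(1) by (simp add: cls_in_integers_iff)
    moreover have "x \<otimes>\<^bsub>K\<^esub> cls (\<lambda>i. inverse (f i)) = \<one>\<^bsub>K\<^esub>"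
      using inv f by (simp add: K_mult K_one cls_eq_iff C_mult)
    ultimately show ?thesis
      by blast
  qed simp
qed (simp_all add: integers_one integers_add integers_mult)

text \<open>If \<open>x\<close> is not integral, then \<open>a x \<ge> 1 / a \<pi>\<close>, so
  \<open>\<pi> * x * x\<close> has value above 1 and a solution \<open>y\<close> satisfies
  \<open>a (y / x) ^ 2 = a \<pi>\<close>. A value whose square is \<open>a \<pi>\<close> lies
  strictly between \<open>a \<pi>\<close> and 1, against the choice of \<open>\<pi>\<close>. For
  integral \<open>x\<close> the right-hand side has value at most \<open>a \<pi> < 1\<close> and
  Newton iteration applies.\<close>

lemma artin_schreier_set_uniformizer:
  assumes \<pi>: "0 < a \<pi>" "a \<pi> < 1" "\<And>y. a y < 1 \<Longrightarrow> a y \<le> a \<pi>"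
  shows "artin_schreier_set K (cls (\<lambda>_. \<pi>)) = integers"
proof -
  have "cls f \<in> artin_schreier_set K (cls (\<lambda>_. \<pi>)) \<longleftrightarrow> cls f \<in> integers" if f: "f \<in> C" for f
  proof
    assume "cls f \<in> integers"
    then have "\<forall>\<^sub>F i in sequentially. a (f i) \<le> 1"
      using f by (simp add: cls_in_integers_iff)
    then have "\<forall>\<^sub>F i in sequentially. a (\<pi> * (f i * f i)) \<le> a \<pi>"
    proof eventually_elim
      case (elim i)
      then have "a (f i) * a (f i) \<le> 1"
        by (simp add: mult_le_one)
      then show ?case
        by (simp add: a_mult mult_left_le)
    qed
    then show "cls f \<in> artin_schreier_set K (cls (\<lambda>_. \<pi>))"
      using artin_schreier_solvable[of "\<lambda>i. \<pi> * (f i * f i)" "a \<pi>"] \<pi> f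
      by (simp add: artin_schreier_set_K_iff C_mult)
  next
    assume "cls f \<in> artin_schreier_set K (cls (\<lambda>_. \<pi>))"
    then obtain g where g: "g \<in> C" "(\<lambda>i. g i * g i + g i - \<pi> * (f i * f i)) \<in> Z"
      using f by (auto simp: artin_schreier_set_K_iff)
    show "cls f \<in> integers"
    proof (rule ccontr)
      assume "cls f \<notin> integers"
      then have "\<forall>\<^sub>F i in sequentially. 1 < a (f i)"
        using f by (simp add: cls_in_integers_iff eventually_le_1_iff)
      \<comment> \<open>A single index at which both bounds hold suffices for the contradiction, so
        the rest of the argument takes place in the base field.\<close>
      then have "\<forall>\<^sub>F i in sequentially. 1 < a (f i) \<and> a (g i * g i + g i - \<pi> * (f i * f i)) < 1"
        using Z_D[OF g(2), of 1] by (simp add: eventually_conj)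
      then obtain i where i: "1 < a (f i)" "a (g i * g i + g i - \<pi> * (f i * f i)) < 1"
        using eventually_happens'[OF sequentially_bot] by blast
      define x y where "x = f i" and "y = g i"
      have x: "1 < a x" "x \<noteq> 0"
        using i(1) by (auto simp: x_def)
      have "a (inverse x) < 1"
        using x(1) by (simp add: a_inverse inverse_less_1_iff)
      then have "inverse (a x) \<le> a \<pi>"
        using \<pi>(3)[of "inverse x"] by (simp add: a_inverse)
      then have "1 \<le> a \<pi> * a x"
        using x pos_divide_le_eq[of "a x" 1 "a \<pi>"] by (simp add: inverse_eq_divide)
      then have "1 * 1 < (a \<pi> * a x) * a x"
        using x(1) by (intro mult_le_less_imp_less) auto
      then have big: "1 < a (\<pi> * (x * x))"
        by (simp add: a_mult mult.assoc)
      \<comment> \<open>The equation holds up to an error of value below 1, which cannot change a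
        value above 1.\<close>
      have "a (y * y + y) = a (\<pi> * (x * x))"
        using a_add_eq[of "y * y + y - \<pi> * (x * x)" "\<pi> * (x * x)"] i(2) big by (simp add: x_def y_def)
      then have eq: "a y * a (y + 1) = a (\<pi> * (x * x))"
        by (simp add: distrib_left flip: a_mult)
      have y: "1 < a y"
      proof (rule ccontr)
        assume "\<not> 1 < a y"
        then have "a y * a (y + 1) \<le> 1"
          using a_ultra[of y 1] by (intro mult_le_one) auto
        then show False
          using eq big by simp
      qed
      then have "a (y + 1) = a y"
        using a_add_eq[of 1 y] by (simp add: add.commute)
      then have sq: "a (y / x) * a (y / x) = a \<pi>"
        using eq x(2) by (simp add: a_divide a_mult field_simps)
      have lt: "a (y / x) < 1"
      proof (rule ccontr)
        assume "\<not> a (y / x) < 1"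
        then have "1 * 1 \<le> a (y / x) * a (y / x)"
          by (intro mult_mono) auto
        then show False
          using sq \<pi>(2) by simp
      qed
      have "0 < a (y / x)"
        using sq \<pi>(1) by (cases "a (y / x) = 0") auto
      then have "a (y / x) * a (y / x) < a (y / x) * 1"
        using lt by (rule mult_strict_left_mono[rotated])
      then show False
        using sq \<pi>(3)[OF lt] by simp
    qed
  qed
  moreover have "artin_schreier_set K (cls (\<lambda>_. \<pi>)) \<subseteq> cls ` C" "integers \<subseteq> cls ` C"
    using artin_schreier_set_subset integers_subset by (simp_all flip: carrier_K)
  ultimately show ?thesis
    by blast
qed

text \<open>The set is filled up in stages: elements close to 0 by Newton iteration, then the
  maximal ideal by descending powers, then integral constants of the number field by their monic
  relation. Every integral element is such a constant plus an element of the maximal ideal.\<close>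

lemma integers_subset_valuation_subring:
  assumes b: "b \<in> carrier K" and val: "valuation_subring K (artin_schreier_set K b)"
  shows "integers \<subseteq> artin_schreier_set K b"
proof
  interpret K: cring K
    by (rule cring_K)
  define S where "S = artin_schreier_set K b"
  obtain b' where b': "b' \<in> C" "b = cls b'"
    using b by (auto simp: carrier_K)
  have S_iff: "cls f \<in> S \<longleftrightarrow> (\<exists>g\<in>C. (\<lambda>i. g i * g i + g i - b' i * (f i * f i)) \<in> Z)" if "f \<in> C" for f
    using that b' by (simp add: S_def artin_schreier_set_K_iff)
  have S_carrier: "S \<subseteq> carrier K"
    unfolding S_def by (rule artin_schreier_set_subset)
  have one: "\<one>\<^bsub>K\<^esub> \<in> S"
    and add_mult: "x \<in> S \<Longrightarrow> y \<in> S \<Longrightarrow> z \<in> S \<Longrightarrow> x \<oplus>\<^bsub>K\<^esub> y \<otimes>\<^bsub>K\<^esub> z \<in> S"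
    and inv: "x \<in> carrier K \<Longrightarrow> x \<notin> S \<Longrightarrow> \<exists>y\<in>S. x \<otimes>\<^bsub>K\<^esub> y = \<one>\<^bsub>K\<^esub>" for x y z
    using val unfolding S_def valuation_subring_def by blast+
  obtain B where B: "0 < B" "\<forall>\<^sub>F i in sequentially. a (b' i) \<le> B"
    using C_eventually_bounded[OF b'(1)] .
  \<comment> \<open>For \<open>a (f i) \<le> \<epsilon> \<le> 1\<close> the right-hand side
    \<open>b' i * (f i * f i)\<close> has value at most \<open>B * \<epsilon> \<le> 1 / 2\<close>,
    within reach of Newton iteration.\<close>
  define \<epsilon> where "\<epsilon> = min 1 (1 / (2 * B))"
  have \<epsilon>: "0 < \<epsilon>" "\<epsilon> \<le> 1" "B * \<epsilon> \<le> 1 / 2"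
    using B(1) by (simp_all add: \<epsilon>_def min_def field_simps)
  have tiny: "cls f \<in> S" if f: "f \<in> C" "\<forall>\<^sub>F i in sequentially. a (f i) \<le> \<epsilon>" for f
  proof -
    have "\<forall>\<^sub>F i in sequentially. a (b' i * (f i * f i)) \<le> 1 / 2"
      using B(2) f(2)
    proof eventually_elim
      case (elim i)
      have "a (b' i * (f i * f i)) \<le> B * (\<epsilon> * 1)"
        unfolding a_mult using elim \<epsilon> B(1) by (intro mult_mono) auto
      then show ?case
        using \<epsilon>(3) by simp
    qed
    then show ?thesis
      using artin_schreier_solvable[of "\<lambda>i. b' i * (f i * f i)" "1 / 2"] f(1) b'(1)
      by (simp add: S_iff C_mult)
  qed
  have zero: "\<zero>\<^bsub>K\<^esub> \<in> S"
    unfolding K_zero using \<epsilon>(1) by (intro tiny) auto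
  have mult: "x \<otimes>\<^bsub>K\<^esub> y \<in> S" if "x \<in> S" "y \<in> S" for x y
    using add_mult[OF zero that] that S_carrier by (simp add: subset_iff)
  have add: "x \<oplus>\<^bsub>K\<^esub> y \<in> S" if "x \<in> S" "y \<in> S" for x y
    using add_mult[OF that one] that S_carrier by (simp add: subset_iff)
  \<comment> \<open>A high power of \<open>f\<close> is close to 0, hence in \<open>S\<close>. If
    \<open>f\<close> were not in \<open>S\<close>, its inverse \<open>y\<close> would be, and
    multiplying by \<open>y\<close> brings the exponent down to 1.\<close>
  have small: "cls f \<in> S" if f: "f \<in> C" "\<forall>\<^sub>F i in sequentially. a (f i) \<le> r" "0 \<le> r" "r < 1" for f r
  proof (rule ccontr)
    assume "cls f \<notin> S"
    then obtain y where y: "y \<in> S" "cls f \<otimes>\<^bsub>K\<^esub> y = \<one>\<^bsub>K\<^esub>"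
      using inv[OF cls_closed[OF f(1)]] by blast
    obtain k where k: "r ^ k < \<epsilon>"
      using real_arch_pow_inv[OF \<epsilon>(1) f(4)] by blast
    have "\<forall>\<^sub>F i in sequentially. a (f i ^ Suc k) \<le> \<epsilon>"
      using f(2)
    proof eventually_elim
      case (elim i)
      then have "a (f i) ^ Suc k \<le> r ^ Suc k"
        by (intro power_mono) auto
      also have "\<dots> \<le> r ^ k"
        using f(3,4) by (simp add: mult_left_le_one_le)
      finally show ?case
        using k unfolding a_power by linarith
    qed
    then have "cls (\<lambda>i. f i ^ Suc k) \<in> S"
      using f(1) by (intro tiny C_power)
    moreover have "cls (\<lambda>i. f i ^ Suc j) \<in> S" if "cls (\<lambda>i. f i ^ Suc (Suc j)) \<in> S" for j
    proof -
      have "cls (\<lambda>i. f i ^ Suc (Suc j)) = cls (\<lambda>i. f i ^ Suc j) \<otimes>\<^bsub>K\<^esub> cls f"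
        using f(1) C_power[OF f(1), of "Suc j"] by (simp add: K_mult mult_ac)
      then have "cls (\<lambda>i. f i ^ Suc (Suc j)) \<otimes>\<^bsub>K\<^esub> y = cls (\<lambda>i. f i ^ Suc j)"
        using y S_carrier f(1) C_power[OF f(1), of "Suc j"] by (auto simp: K.m_assoc)
      then show ?thesis
        using mult[OF that y(1)] by simp
    qed
    ultimately have "cls (\<lambda>i. f i ^ Suc 0) \<in> S"
      by (rule inc_induct[of 0 k "\<lambda>j. cls (\<lambda>i. f i ^ Suc j) \<in> S", rotated]) auto
    then show False
      using \<open>cls f \<notin> S\<close> by simp
  qed
  have const: "cls (\<lambda>_. y) \<in> S" if "a y \<le> 1" for y
  proof -
    obtain d e where "a (y ^ d + (\<Sum>i<d. of_int (e i) * y ^ i)) < 1"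
      using ex_monic_relation[OF \<open>a y \<le> 1\<close>] .
    then have "y \<in> {y. cls (\<lambda>_. y) \<in> S}"
    proof (rule valuation_subring_superset[rotated -1])
      show "1 \<in> {y. cls (\<lambda>_. y) \<in> S}"
        using one by (simp add: K_one)
      \<comment> \<open>\<open>S_iff\<close> involves \<open>f\<close> only through its square, so 1
        and \<open>-1\<close> satisfy the same condition.\<close>
      then show "-1 \<in> {y. cls (\<lambda>_. y) \<in> S}"
        by (simp add: S_iff)
      show "x + y * z \<in> {y. cls (\<lambda>_. y) \<in> S}"
        if "x \<in> {y. cls (\<lambda>_. y) \<in> S}" "y \<in> {y. cls (\<lambda>_. y) \<in> S}" "z \<in> {y. cls (\<lambda>_. y) \<in> S}" for x y z
        using add_mult[of "cls (\<lambda>_. x)" "cls (\<lambda>_. y)" "cls (\<lambda>_. z)"] that by (simp add: K_add K_mult)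
      show "x \<in> {y. cls (\<lambda>_. y) \<in> S}" if "a x < 1" for x
        using small[of "\<lambda>_. x" "a x"] that by simp
      show "inverse x \<in> {y. cls (\<lambda>_. y) \<in> S}" if x: "x \<notin> {y. cls (\<lambda>_. y) \<in> S}" for x
      proof -
        obtain y where y: "y \<in> S" "cls (\<lambda>_. x) \<otimes>\<^bsub>K\<^esub> y = \<one>\<^bsub>K\<^esub>"
          using inv[of "cls (\<lambda>_. x)"] x by auto
        have "x \<noteq> 0"
          using x zero by (auto simp: K_zero)
        then have "cls (\<lambda>_. inverse x) \<otimes>\<^bsub>K\<^esub> cls (\<lambda>_. x) = \<one>\<^bsub>K\<^esub>"
          by (simp add: K_mult K_one)
        then have "cls (\<lambda>_. inverse x) = y"
          using y S_carrier K.inv_unique[of "cls (\<lambda>_. inverse x)" "cls (\<lambda>_. x)" y] by auto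
        then show ?thesis
          using y(1) by simp
      qed
    qed
    then show ?thesis
      by simp
  qed
  fix x assume "x \<in> integers"
  then obtain f where f: "f \<in> C" "x = cls f" "\<forall>\<^sub>F i in sequentially. a (f i) \<le> 1"
    by (auto simp: integers_def)
  obtain N where N: "\<And>i. N \<le> i \<Longrightarrow> a (f i) \<le> 1"
    using f(3) by (auto simp: eventually_sequentially)
  obtain M where M: "\<And>i j. M \<le> i \<Longrightarrow> M \<le> j \<Longrightarrow> a (f i - f j) < 1 / 2"
    using C_D[OF f(1), of "1 / 2"] by auto
  \<comment> \<open>A late term of \<open>f\<close> is a constant within \<open>1 / 2\<close> of
    \<open>f\<close>, by density of the number field in its completion; an index from
    \<open>N\<close> on makes it integral.\<close>
  define c where "c = f (max M N)"
  have "\<forall>\<^sub>F i in sequentially. a (f i - c) \<le> 1 / 2"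
    unfolding eventually_sequentially c_def using M less_imp_le by (metis max.cobounded1)
  then have "cls (\<lambda>i. f i - c) \<in> S"
    using f(1) by (intro small[of _ "1 / 2"] C_diff) auto
  moreover have "cls (\<lambda>_. c) \<in> S"
    using N[of "max M N"] by (intro const) (simp add: c_def)
  ultimately have "cls (\<lambda>i. f i - c) \<oplus>\<^bsub>K\<^esub> cls (\<lambda>_. c) \<in> S"
    by (rule add)
  then show "x \<in> artin_schreier_set K b"
    using f(1,2) by (simp add: K_add C_diff S_def)
qed

text \<open>The parameter \<open>cls (\<lambda>_. \<pi>)\<close> occurs among the admissible
  \<open>b\<close> and cuts the intersection down to \<open>integers\<close>.\<close>

theorem sat_integer_form_K:
  assumes "\<alpha> ((), k) \<in> carrier K"
  shows "sat (ring_structure K) \<alpha> (integer_form k) \<longleftrightarrow> \<alpha> ((), k) \<in> integers"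
proof -
  obtain \<pi> where "0 < a \<pi>" "a \<pi> < 1" "\<And>y. a y < 1 \<Longrightarrow> a y \<le> a \<pi>"
    using ex_uniformizer by blast
  note \<pi> = artin_schreier_set_uniformizer[OF this]
  have "\<alpha> ((), k) \<in> integers \<longleftrightarrow>
    (\<forall>b\<in>carrier K. valuation_subring K (artin_schreier_set K b) \<longrightarrow>
       \<alpha> ((), k) \<in> artin_schreier_set K b)"
  proof
    assume "\<alpha> ((), k) \<in> integers"
    then show "\<forall>b\<in>carrier K. valuation_subring K (artin_schreier_set K b) \<longrightarrow>
       \<alpha> ((), k) \<in> artin_schreier_set K b"
      using integers_subset_valuation_subring by blast
  next
    assume all: "\<forall>b\<in>carrier K. valuation_subring K (artin_schreier_set K b) \<longrightarrow>
       \<alpha> ((), k) \<in> artin_schreier_set K b"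
    then have "valuation_subring K (artin_schreier_set K (cls (\<lambda>_. \<pi>))) \<longrightarrow>
       \<alpha> ((), k) \<in> artin_schreier_set K (cls (\<lambda>_. \<pi>))"
      by (rule bspec) simp
    then show "\<alpha> ((), k) \<in> integers"
      by (simp add: \<pi> valuation_subring_integers)
  qed
  then show ?thesis
    using sat_integer_form[of K \<alpha> k] cring.axioms(1)[OF cring_K] assms by simp
qed

end

section \<open>Finite adeles\<close>

lemma place_abs_nonarch:
  assumes "v \<in> finite_places"
  shows "place_abs v \<in> nonarch_absolute_values"
proof -
  obtain b where b: "b \<in> nonarch_absolute_values"
    "v = (equivalent_absolute_values \<inter> nonarch_absolute_values \<times> nonarch_absolute_values) `` {b}"
    using assms by (auto simp: finite_places_def elim: quotientE)
  have "\<forall>x. b x = b x powr 1"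
    using b(1) by (simp add: nonarch_absolute_values_def absolute_value_def)
  then have "(b, b) \<in> equivalent_absolute_values"
    using zero_less_one unfolding equivalent_absolute_values_def by blast
  then have "b \<in> v"
    using b by auto
  then have "place_abs v \<in> v"
    unfolding place_abs_def by (rule someI[of "\<lambda>a. a \<in> v"])
  then show ?thesis
    using b(2) by auto
qed

lemma (in nonarch_field)
  assumes "place_abs v = a"
  shows completion_eq: "completion v = K" and valuation_ring_eq: "valuation_ring v = integers"
proof -
  show K: "completion v = K"
    by (simp add: completion_def K_def assms)
  have "c \<in> valuation_ring v \<longleftrightarrow> c \<in> integers" if "c \<in> carrier K" for c
    using that
    by (auto simp: carrier_K valuation_ring_def K completion_abs_def assms limit_le_1_iff
        cls_in_integers_iff)
  moreover have "valuation_ring v \<subseteq> carrier K"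
    by (auto simp: valuation_ring_def K)
  ultimately show "valuation_ring v = integers"
    using integers_subset by blast
qed

lemma finite_adeles_definable_restricted_product:
  assumes "number_field TYPE('k::field_char_0)"
  shows "definable_restricted_product (finite_places :: 'k place set) completion valuation_ring integer_form"
proof -
  obtain n where n: "\<And>x::'k. \<exists>c :: nat \<Rightarrow> int. (\<exists>i\<le>n. c i \<noteq> 0) \<and> (\<Sum>i\<le>n. of_int (c i) * x ^ i) = 0"
    using number_field_integer_relation[OF assms] by blast
  have loc: "number_field_abs (place_abs v) n" if "v \<in> finite_places" for v :: "'k place"
    using place_abs_nonarch[OF that] n by (simp add: number_field_abs_def nonarch_field_def number_field_abs_axioms_def)
  show ?thesis
  proof (rule definable_restricted_product.intro)
    fix v :: "'k place" assume v: "v \<in> finite_places"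
    interpret number_field_abs "place_abs v" n
      by (rule loc[OF v])
    note eqs = completion_eq[OF refl] valuation_ring_eq[OF refl]
    show "ring (completion v)"
      unfolding eqs by (rule cring.axioms(1)[OF cring_K])
    show "valuation_ring v \<subseteq> carrier (completion v)"
      "\<zero>\<^bsub>completion v\<^esub> \<in> valuation_ring v" "\<one>\<^bsub>completion v\<^esub> \<in> valuation_ring v"
      unfolding eqs by (rule integers_subset integers_zero integers_one)+
    fix x y
    show "\<ominus>\<^bsub>completion v\<^esub> x \<in> valuation_ring v" if "x \<in> valuation_ring v"
      using that unfolding eqs by (rule integers_minus)
    show "x \<oplus>\<^bsub>completion v\<^esub> y \<in> valuation_ring v" "x \<otimes>\<^bsub>completion v\<^esub> y \<in> valuation_ring v"
      if "x \<in> valuation_ring v" "y \<in> valuation_ring v"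
      using that unfolding eqs by (rule integers_add integers_mult)+
    show "sat (ring_structure (completion v)) \<alpha> (integer_form k) \<longleftrightarrow> \<alpha> ((), k) \<in> valuation_ring v"
      if "\<alpha> ((), k) \<in> carrier (completion v)" for \<alpha> k
      using that unfolding eqs by (rule sat_integer_form_K)
  qed (rule formula_integer_form free_vars_integer_form)+
qed

section \<open>Translation of ring formulas into \<open>L\<close>\<close>

primrec translate_term ::
  "'s \<Rightarrow> (ring_symbol \<Rightarrow> 'f) \<Rightarrow> (unit, ring_symbol) fo_term \<Rightarrow> ('s, 'f) fo_term" where
  "translate_term h \<iota> (Var x) = Var (h, snd x)"
| "translate_term h \<iota> (App f ts) = App (\<iota> f) (map (translate_term h \<iota>) ts)"

primrec translate ::
  "'s \<Rightarrow> (ring_symbol \<Rightarrow> 'f) \<Rightarrow> (unit, ring_symbol, unit) fo_form \<Rightarrow> ('s, 'f, 'r) fo_form" where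
  "translate h \<iota> (Eq t u) = Eq (translate_term h \<iota> t) (translate_term h \<iota> u)"
| "translate h \<iota> (Rel r ts) = Rel undefined (map (translate_term h \<iota>) ts)"
| "translate h \<iota> (Neg \<phi>) = Neg (translate h \<iota> \<phi>)"
| "translate h \<iota> (Conj \<phi> \<psi>) = Conj (translate h \<iota> \<phi>) (translate h \<iota> \<psi>)"
| "translate h \<iota> (Exists x \<phi>) = Exists (h, snd x) (translate h \<iota> \<phi>)"

lemma term_vars_translate_term:
  "term_vars (translate_term h \<iota> t) = (\<lambda>x. (h, snd x)) ` term_vars t"
  by (induction t) auto

lemma free_vars_translate: "free_vars (translate h \<iota> \<phi>) = (\<lambda>x. (h, snd x)) ` free_vars \<phi>"
proof (induction \<phi>)
  case (Exists x \<phi>)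
  then show ?case
    by (cases x) (force simp: image_iff)
qed (auto simp: term_vars_translate_term)

lemma has_sort_translate_term:
  assumes "extends_ring_language L h \<iota>" "has_sort ring_language t ()"
  shows "has_sort L (translate_term h \<iota> t) h"
proof -
  have app: "has_sort L (App (\<iota> f) ts) h" if "list_all2 (has_sort L) ts (replicate (ring_arity f) h)" for f ts
    using has_sort.intros(2)[of "\<iota> f" L ts] that assms(1) by (simp add: extends_ring_language_def)
  have h: "h \<in> sorts L"
    using assms(1) by (simp add: extends_ring_language_def)
  show ?thesis
    using assms(2)
    by (induction rule: ring_term_induct) (auto intro!: app has_sort.intros(1) simp: h numeral_2_eq_2)
qed

lemma formula_translate:
  assumes "extends_ring_language L h \<iota>" "formula ring_language \<phi>"
  shows "formula L (translate h \<iota> \<phi>)"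
  using assms(2)
proof (induction \<phi>)
  case (Eq t u)
  then show ?case
    using has_sort_translate_term[OF assms(1)] by (auto intro!: exI[of _ h])
next
  case (Exists x \<phi>)
  then show ?case
    using assms(1) by (simp add: extends_ring_language_def)
qed simp_all

lemma eval_translate_term:
  assumes "expands_ring L h \<iota> R M" "ring R" "has_sort ring_language t ()"
    and "\<And>x. x \<in> term_vars t \<Longrightarrow> \<alpha> x \<in> carrier R \<and> \<beta> (h, snd x) = Inl (\<alpha> x)"
  shows "eval_term M \<beta> (translate_term h \<iota> t) = Inl (eval_term (ring_structure R) \<alpha> t)"
proof -
  have app: "fun_int M (\<iota> f) (map Inl as) = Inl (ring_int R f as)"
    if "set as \<subseteq> carrier R" "length as = ring_arity f" for f as
    using assms(1) that by (simp add: expands_ring_def)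
  show ?thesis
    using assms(3,4)
  proof (induction rule: ring_term_induct)
    case RZero
    then show ?case using app[of "[]" RZero] by simp
  next
    case ROne
    then show ?case using app[of "[]" ROne] by simp
  next
    case (RAdd t u)
    then show ?case
      using app[of "[eval_term (ring_structure R) \<alpha> t, eval_term (ring_structure R) \<alpha> u]" RAdd]
      by (simp add: eval_ring_term_closed[OF assms(2)])
  next
    case (RNeg t)
    then show ?case
      using app[of "[eval_term (ring_structure R) \<alpha> t]" RNeg]
      by (simp add: eval_ring_term_closed[OF assms(2)])
  next
    case (RMult t u)
    then show ?case
      using app[of "[eval_term (ring_structure R) \<alpha> t, eval_term (ring_structure R) \<alpha> u]" RMult]
      by (simp add: eval_ring_term_closed[OF assms(2)])
  qed simp
qed

text \<open>Quantifiers match because sort \<open>h\<close> of \<open>M\<close> is exactly the image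
  of the carrier under \<open>Inl\<close>; the induction varies both assignments.\<close>

lemma sat_translate:
  assumes "expands_ring L h \<iota> R M" "ring R" "formula ring_language \<phi>"
    and "\<And>x. x \<in> free_vars \<phi> \<Longrightarrow> \<alpha> x \<in> carrier R \<and> \<beta> (h, snd x) = Inl (\<alpha> x)"
  shows "sat M \<beta> (translate h \<iota> \<phi>) \<longleftrightarrow> sat (ring_structure R) \<alpha> \<phi>"
  using assms(3,4)
proof (induction \<phi> arbitrary: \<alpha> \<beta>)
  case (Eq t u)
  then have "eval_term M \<beta> (translate_term h \<iota> t) = Inl (eval_term (ring_structure R) \<alpha> t)"
    "eval_term M \<beta> (translate_term h \<iota> u) = Inl (eval_term (ring_structure R) \<alpha> u)"
    by (intro eval_translate_term[OF assms(1,2)]; auto)+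
  then show ?case
    by simp
next
  case (Neg \<phi>)
  then show ?case
    using Neg.IH[of \<alpha> \<beta>] by simp
next
  case (Conj \<phi> \<psi>)
  then show ?case
  proof -
    have "sat M \<beta> (translate h \<iota> \<phi>) \<longleftrightarrow> sat (ring_structure R) \<alpha> \<phi>"
      by (rule Conj.IH(1)) (use Conj.prems in auto)
    moreover have "sat M \<beta> (translate h \<iota> \<psi>) \<longleftrightarrow> sat (ring_structure R) \<alpha> \<psi>"
      by (rule Conj.IH(2)) (use Conj.prems in auto)
    ultimately show ?thesis
      by simp
  qed
next
  case (Exists x \<phi>)
  have univ: "univ M h = Inl ` carrier R"
    using assms(1) by (simp add: expands_ring_def)
  have "sat M (\<beta>((h, snd x) := Inl c)) (translate h \<iota> \<phi>) \<longleftrightarrow>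
      sat (ring_structure R) (\<alpha>(x := c)) \<phi>" if c: "c \<in> carrier R" for c
  proof (rule Exists.IH)
    fix z assume z: "z \<in> free_vars \<phi>"
    show "(\<alpha>(x := c)) z \<in> carrier R \<and> (\<beta>((h, snd x) := Inl c)) (h, snd z) = Inl ((\<alpha>(x := c)) z)"
    proof (cases "z = x")
      case False
      then have "snd z \<noteq> snd x"
        by (simp add: prod_eq_iff)
      then show ?thesis
        using Exists.prems(2)[of z] z False by simp
    qed (use c in simp)
  qed (use Exists.prems(1) in simp)
  then show ?case
    by (simp add: univ)
qed simp

section \<open>Boolean combinations and counting conditions\<close>

lemma at_least_iff: "at_least j Y \<longleftrightarrow> (finite Y \<longrightarrow> j \<le> card Y)"
proof (cases "finite Y")
  case True
  then show ?thesis
    unfolding at_least_def by (metis card_mono obtain_subset_with_card_n)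
next
  case False
  then show ?thesis
    unfolding at_least_def using infinite_arbitrarily_large by blast
qed

context
  fixes \<Omega> :: "'a set" and \<G> :: "'a set set"
  assumes sub: "\<And>A. A \<in> \<G> \<Longrightarrow> A \<subseteq> \<Omega>" and nonempty: "\<G> \<noteq> {}"
begin

lemma boolean_combinations_subset: "A \<in> boolean_combinations \<Omega> \<G> \<Longrightarrow> A \<subseteq> \<Omega>"
  by (induction rule: boolean_combinations.induct) (auto dest: sub)

text \<open>Obtained as \<open>A \<union> (\<Omega> - A)\<close>, which takes one generator to start
  from.\<close>

lemma boolean_combinations_top: "\<Omega> \<in> boolean_combinations \<Omega> \<G>"
proof -
  obtain A where A: "A \<in> boolean_combinations \<Omega> \<G>"
    using nonempty boolean_combinations.intros(1) by blast
  then have "A \<union> (\<Omega> - A) \<in> boolean_combinations \<Omega> \<G>"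
    by (intro boolean_combinations.intros(2,3))
  then show ?thesis
    using boolean_combinations_subset[OF A] by (simp add: Un_absorb1)
qed

lemma boolean_combinations_empty: "{} \<in> boolean_combinations \<Omega> \<G>"
  using boolean_combinations.intros(2)[OF boolean_combinations_top] by simp

lemma boolean_combinations_Int:
  assumes "A \<in> boolean_combinations \<Omega> \<G>" "B \<in> boolean_combinations \<Omega> \<G>"
  shows "A \<inter> B \<in> boolean_combinations \<Omega> \<G>"
proof -
  have "\<Omega> - ((\<Omega> - A) \<union> (\<Omega> - B)) \<in> boolean_combinations \<Omega> \<G>"
    by (intro boolean_combinations.intros(2,3) assms)
  moreover have "\<Omega> - ((\<Omega> - A) \<union> (\<Omega> - B)) = A \<inter> B"
    using boolean_combinations_subset assms by blast
  ultimately show ?thesis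
    by simp
qed

lemma boolean_combinations_UN:
  assumes "finite T" "\<And>t. t \<in> T \<Longrightarrow> f t \<in> boolean_combinations \<Omega> \<G>"
  shows "(\<Union>t\<in>T. f t) \<in> boolean_combinations \<Omega> \<G>"
  using assms by (induction T rule: finite_induct)
    (auto intro: boolean_combinations_empty boolean_combinations.intros(3))

lemma boolean_combinations_INT:
  assumes "finite T" "\<And>t. t \<in> T \<Longrightarrow> f t \<in> boolean_combinations \<Omega> \<G>"
  shows "{x\<in>\<Omega>. \<forall>t\<in>T. x \<in> f t} \<in> boolean_combinations \<Omega> \<G>"
  using assms
proof (induction T rule: finite_induct)
  case empty
  then show ?case
    using boolean_combinations_top by simp
next
  case (insert t T)
  have "{x\<in>\<Omega>. \<forall>s\<in>insert t T. x \<in> f s} = f t \<inter> {x\<in>\<Omega>. \<forall>s\<in>T. x \<in> f s}"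
    using boolean_combinations_subset[OF insert.prems[of t]] by auto
  then show ?case
    using boolean_combinations_Int[OF insert.prems[of t] insert.IH] insert.prems by simp
qed

text \<open>\<open>Some k\<close> with \<open>k < J\<close> means exactly \<open>k\<close> elements,
  while \<open>Some J\<close> means finite with at least \<open>J\<close>; \<open>None\<close> is
  the complement of finiteness.\<close>

lemma boolean_combinations_trunc_card:
  assumes fin: "{x\<in>\<Omega>. finite (D x)} \<in> boolean_combinations \<Omega> \<G>"
    and at_least: "\<And>j. 1 \<le> j \<Longrightarrow> {x\<in>\<Omega>. at_least j (D x)} \<in> boolean_combinations \<Omega> \<G>"
  shows "{x\<in>\<Omega>. trunc_card J (D x) = t} \<in> boolean_combinations \<Omega> \<G>"
proof (cases t)
  case None
  then have "{x\<in>\<Omega>. trunc_card J (D x) = t} = \<Omega> - {x\<in>\<Omega>. finite (D x)}"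
    by (auto simp: trunc_card_eq_None_iff)
  then show ?thesis
    using boolean_combinations.intros(2)[OF fin] by simp
next
  case (Some k)
  \<comment> \<open>The hypothesis covers \<open>j \<ge> 1\<close>, but 0 occurs below as well; it
    gives the whole of \<open>\<Omega>\<close>.\<close>
  have al: "{x\<in>\<Omega>. at_least j (D x)} \<in> boolean_combinations \<Omega> \<G>" for j
  proof (cases "1 \<le> j")
    case False
    then have "{x\<in>\<Omega>. at_least j (D x)} = \<Omega>"
      by (auto simp: at_least_iff)
    then show ?thesis
      using boolean_combinations_top by simp
  qed (rule at_least)
  consider "J < k" | "k = J" | "k < J"
    by linarith
  then show ?thesis
  proof cases
    case 1
    then have "{x\<in>\<Omega>. trunc_card J (D x) = t} = {}"
      by (auto simp: Some trunc_card_def)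
    then show ?thesis
      using boolean_combinations_empty by (simp only:)
  next
    case 2
    then have "{x\<in>\<Omega>. trunc_card J (D x) = t} = {x\<in>\<Omega>. finite (D x)} \<inter> {x\<in>\<Omega>. at_least J (D x)}"
      by (auto simp: Some trunc_card_def at_least_iff)
    then show ?thesis
      using boolean_combinations_Int[OF fin al] by (simp only:)
  next
    case 3
    then have "{x\<in>\<Omega>. trunc_card J (D x) = t} = {x\<in>\<Omega>. finite (D x)} \<inter>
        ({x\<in>\<Omega>. at_least k (D x)} \<inter> (\<Omega> - {x\<in>\<Omega>. at_least (Suc k) (D x)}))"
      by (auto simp: Some trunc_card_def at_least_iff min_def split: if_splits)
    then show ?thesis
      using boolean_combinations_Int[OF fin boolean_combinations_Int[OF al boolean_combinations.intros(2)[OF al]]]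
      by (simp only:)
  qed
qed

text \<open>\<open>X\<close> is a union of classes of points with equal values of all
  \<open>N s\<close>. As \<open>P\<close> and \<open>T\<close> are finite, there are only finitely
  many classes, each a finite intersection of given sets.\<close>

lemma boolean_combinations_types:
  assumes "finite P" "finite T"
    and N: "\<And>s t. s \<in> P \<Longrightarrow> {x\<in>\<Omega>. N s x = t} \<in> boolean_combinations \<Omega> \<G>"
    and T: "\<And>s x. s \<in> P \<Longrightarrow> x \<in> \<Omega> \<Longrightarrow> N s x \<in> T"
    and X: "X \<subseteq> \<Omega>" "\<And>x y. x \<in> X \<Longrightarrow> y \<in> \<Omega> \<Longrightarrow> (\<And>s. s \<in> P \<Longrightarrow> N s x = N s y) \<Longrightarrow> y \<in> X"
  shows "X \<in> boolean_combinations \<Omega> \<G>"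
proof -
  define \<tau> where "\<tau> x = (\<lambda>s\<in>P. N s x)" for x
  have "\<tau> ` X \<subseteq> P \<rightarrow>\<^sub>E T"
    using T X(1) by (auto simp: \<tau>_def)
  then have fin: "finite (\<tau> ` X)"
    by (rule finite_subset) (intro finite_PiE assms(1,2))
  have "X = (\<Union>t\<in>\<tau> ` X. {x\<in>\<Omega>. \<forall>s\<in>P. x \<in> {x\<in>\<Omega>. N s x = t s}})"
    using X by (fastforce simp: \<tau>_def)
  moreover have "\<dots> \<in> boolean_combinations \<Omega> \<G>"
    by (intro boolean_combinations_UN[OF fin] boolean_combinations_INT[OF assms(1)] N)
  ultimately show ?thesis
    by simp
qed

end

section \<open>From local patterns to sets of type I and II\<close>

lemma quantified_sorts_subset: "formula L \<phi> \<Longrightarrow> quantified_sorts \<phi> \<subseteq> sorts L"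
  by (induction \<phi>) auto

lemma tuples_component: "x \<in> tuples R m \<Longrightarrow> i < m \<Longrightarrow> x i \<in> carrier R"
  by (auto simp: tuples_def)

text \<open>The property \<open>Q\<close> is left open so that the same argument gives formulas
  without quantifiers in \<open>\<sigma>\<close> and, for one sort, formulas without any
  quantifiers. For each pattern \<open>S\<close> the fibre counted by \<open>same_counts\<close> is
  the Boolean value of one formula \<open>\<psi> S\<close>.\<close>

lemma ring_definable_boolean_combination:
  fixes M :: "'k::field_char_0 place \<Rightarrow> ('s, 'f, 'r, 'k completed + 'b) fo_structure"
  assumes "number_field TYPE('k)" "ring_definable finite_adeles m X"
    and translation: "\<And>\<chi>. formula ring_language \<chi> \<Longrightarrow> free_vars \<chi> \<subseteq> {()} \<times> {..<m} \<Longrightarrow>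
      \<exists>\<psi>. formula L \<psi> \<and> free_vars \<psi> \<subseteq> {h} \<times> {..<m} \<and> Q \<psi> \<and>
        (\<forall>x\<in>tuples finite_adeles m. boolean_value finite_places M \<psi> x =
           {v\<in>finite_places. sat (ring_structure (completion v)) (\<lambda>(_, i). x i v) \<chi>})"
  shows "X \<in> boolean_combinations (tuples finite_adeles m)
    (type_I_sets L h M m Q \<union> type_II_sets L h M m Q)" (is "X \<in> boolean_combinations ?\<Omega> ?\<G>")
proof -
  interpret definable_restricted_product "finite_places :: 'k place set" completion valuation_ring integer_form
    by (rule finite_adeles_definable_restricted_product[OF assms(1)])
  have A: "A = finite_adeles"
    by (simp add: finite_adeles_def)
  obtain \<Phi> where \<Phi>: "formula ring_language \<Phi>" "free_vars \<Phi> \<subseteq> {()} \<times> {..<m}"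
    "X = {x \<in> ?\<Omega>. sat (ring_structure A) (\<lambda>(_, i). x i) \<Phi>}"
    using assms(2) unfolding ring_definable_def A by blast
  obtain F J where FJ: "determines F J \<Phi>"
    using ex_determines[OF \<Phi>(1)] by blast
  then have F: "finite F" "\<And>\<phi>. \<phi> \<in> F \<Longrightarrow> formula ring_language \<phi>"
    "\<And>\<phi>. \<phi> \<in> F \<Longrightarrow> free_vars \<phi> \<subseteq> free_vars \<Phi>"
    by (auto simp: determines_def)
  \<comment> \<open>\<open>S \<inter> F\<close> makes the condition satisfiable for every
    \<open>S\<close>, so that \<open>\<psi>\<close> can be chosen as a total function.\<close>
  define good where "good S \<psi> \<longleftrightarrow> formula L \<psi> \<and> free_vars \<psi> \<subseteq> {h} \<times> {..<m} \<and> Q \<psi> \<and>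
      (\<forall>x\<in>?\<Omega>. boolean_value finite_places M \<psi> x =
         {v\<in>finite_places. pattern F (\<lambda>(_, i). x i) v = S \<inter> F})" for S \<psi>
  have ex_good: "\<exists>\<psi>. good S \<psi>" for S
  proof -
    obtain \<chi> where \<chi>: "formula ring_language \<chi>" "free_vars \<chi> \<subseteq> \<Union> (free_vars ` F)"
      "\<And>(N :: (unit, ring_symbol, unit, 'k completed) fo_structure) \<alpha>.
         sat N \<alpha> \<chi> \<longleftrightarrow> {\<phi>\<in>F. sat N \<alpha> \<phi>} = S \<inter> F"
      using ex_pattern_formula[OF F(1,2), where 'u = "'k completed" and S = S] by blast
    have "free_vars \<chi> \<subseteq> {()} \<times> {..<m}"
      using \<chi>(2) F(3) \<Phi>(2) by blast
    moreover have "pattern F (\<lambda>(_, i). x i) v =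
        {\<phi>\<in>F. sat (ring_structure (completion v)) (\<lambda>(_, i). x i v) \<phi>}"
      for x :: "nat \<Rightarrow> 'k place \<Rightarrow> 'k completed" and v
      by (simp add: pattern_def case_prod_unfold)
    ultimately show ?thesis
      using translation[OF \<chi>(1)] unfolding \<chi>(3) good_def by simp
  qed
  define \<psi> where "\<psi> S = (SOME \<psi>. good S \<psi>)" for S
  have good: "good S (\<psi> S)" for S
    unfolding \<psi>_def by (rule someI_ex[OF ex_good])
  have \<psi>: "formula L (\<psi> S)" "free_vars (\<psi> S) \<subseteq> {h} \<times> {..<m}" "Q (\<psi> S)" for S
    using good[of S] by (simp_all add: good_def)
  have boolean_value_\<psi>: "boolean_value finite_places M (\<psi> S) x =
         {v\<in>finite_places. pattern F (\<lambda>(_, i). x i) v = S \<inter> F}" if "x \<in> ?\<Omega>" for S x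
    using good[of S] that by (simp add: good_def)
  have type_II: "{x\<in>?\<Omega>. finite (boolean_value finite_places M (\<psi> S) x)} \<in> ?\<G>" for S
    using \<psi> unfolding type_II_sets_def by blast
  have type_I: "{x\<in>?\<Omega>. at_least j (boolean_value finite_places M (\<psi> S) x)} \<in> ?\<G>" if "1 \<le> j" for S j
    using \<psi> that unfolding type_I_sets_def by blast
  have sub: "Y \<subseteq> ?\<Omega>" if "Y \<in> ?\<G>" for Y
    using that by (auto simp: type_I_sets_def type_II_sets_def)
  have nonempty: "?\<G> \<noteq> {}"
    using type_II by blast
  show ?thesis
  proof (rule boolean_combinations_types[OF sub nonempty])
    show "finite (Pow F)"
      using F(1) by simp
    show "finite (insert None (Some ` {..J}))"
      by simp
    show "{x\<in>?\<Omega>. trunc_card J (boolean_value finite_places M (\<psi> S) x) = t}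
        \<in> boolean_combinations ?\<Omega> ?\<G>" for S t
      using type_I type_II
      by (intro boolean_combinations_trunc_card[OF sub nonempty] boolean_combinations.intros(1))
    show "trunc_card J (boolean_value finite_places M (\<psi> S) x) \<in> insert None (Some ` {..J})" for S x
      by (auto simp: trunc_card_def)
    show "X \<subseteq> ?\<Omega>"
      by (auto simp: \<Phi>(3))
    fix x y assume x: "x \<in> X" and y: "y \<in> ?\<Omega>"
      and same: "\<And>S. S \<in> Pow F \<Longrightarrow> trunc_card J (boolean_value finite_places M (\<psi> S) x) =
        trunc_card J (boolean_value finite_places M (\<psi> S) y)"
    have x': "x \<in> ?\<Omega>"
      using x by (simp add: \<Phi>(3))
    have "same_counts J finite_places (pattern F (\<lambda>(_, i). x i)) (pattern F (\<lambda>(_, i). y i))"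
      unfolding same_counts_def
    proof
      fix S
      show "trunc_card J {v\<in>finite_places. pattern F (\<lambda>(_, i). x i) v = S} =
        trunc_card J {v\<in>finite_places. pattern F (\<lambda>(_, i). y i) v = S}"
      proof (cases "S \<subseteq> F")
        case True
        then show ?thesis
          using same[of S] by (simp add: boolean_value_\<psi>[OF x'] boolean_value_\<psi>[OF y] Int_absorb2)
      next
        case False
        \<comment> \<open>Patterns are subsets of \<open>F\<close>, so such an \<open>S\<close> is
          attained at no index for either tuple.\<close>
        then have "{v\<in>finite_places. pattern F \<alpha> v = S} = {}" for \<alpha>
          by (auto simp: pattern_def)
        then show ?thesis
          by (simp only:)
      qed
    qed
    then have "sat (ring_structure A) (\<lambda>(_, i). x i) \<Phi> \<longleftrightarrow> sat (ring_structure A) (\<lambda>(_, i). y i) \<Phi>"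
      by (rule determines_iff[OF FJ, rotated 2])
        (use \<Phi>(2) tuples_component[OF x'] tuples_component[OF y] in \<open>auto simp: A\<close>)
    then show "y \<in> X"
      using x y by (simp add: \<Phi>(3))
  qed
qed

theorem theorem7p2:
  fixes L :: "('s, 'f, 'r) fo_signature"
    and h \<sigma> :: 's
    and \<iota> :: "ring_symbol \<Rightarrow> 'f"
    and M :: "'k::field_char_0 place \<Rightarrow> ('s, 'f, 'r, 'k completed + 'b) fo_structure"
    and m :: nat
    and X :: "(nat \<Rightarrow> 'k place \<Rightarrow> 'k completed) set"
  assumes "number_field TYPE('k)"
    and "1 \<le> m"
    and "X \<subseteq> tuples finite_adeles m"
    and "ring_definable finite_adeles m X"
    and "extends_ring_language L h \<iota>"
    and "\<And>v. v \<in> finite_places \<Longrightarrow> expands_ring L h \<iota> (completion v) (M v)"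
    and "\<sigma> \<in> sorts L"
    and "uniform_qe L \<sigma> finite_places M"
  shows "X \<in> boolean_combinations (tuples finite_adeles m)
           (type_I_sets L h M m (quantifier_free_in \<sigma>) \<union>
            type_II_sets L h M m (quantifier_free_in \<sigma>))
       \<and> (sorts L = {\<sigma>} \<longrightarrow>
          X \<in> boolean_combinations (tuples finite_adeles m)
            (type_I_sets L h M m quantifier_free \<union> type_II_sets L h M m quantifier_free))"
proof -
  interpret definable_restricted_product "finite_places :: 'k place set" completion valuation_ring integer_form
    by (rule finite_adeles_definable_restricted_product[OF assms(1)])
  have A: "A = finite_adeles"
    by (simp add: finite_adeles_def)
  \<comment> \<open>Quantifier elimination is applied to the translation into \<open>L\<close>;
    being uniform in \<open>v\<close>, it gives one formula for all places.\<close>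
  have translation: "\<exists>\<psi>. formula L \<psi> \<and> free_vars \<psi> \<subseteq> {h} \<times> {..<m} \<and> quantifier_free_in \<sigma> \<psi> \<and>
      (\<forall>x\<in>tuples finite_adeles m. boolean_value finite_places M \<psi> x =
         {v\<in>finite_places. sat (ring_structure (completion v)) (\<lambda>(_, i). x i v) \<chi>})"
    if \<chi>: "formula ring_language \<chi>" "free_vars \<chi> \<subseteq> {()} \<times> {..<m}" for \<chi>
  proof -
    have vars: "free_vars (translate h \<iota> \<chi> :: ('s, 'f, 'r) fo_form) \<subseteq> {h} \<times> {..<m}"
      using \<chi>(2) by (auto simp: free_vars_translate)
    obtain \<psi> where \<psi>: "formula L \<psi>" "free_vars \<psi> \<subseteq> free_vars (translate h \<iota> \<chi> :: ('s, 'f, 'r) fo_form)"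
      "quantifier_free_in \<sigma> \<psi>"
      "\<And>v \<alpha>. v \<in> finite_places \<Longrightarrow>
        (\<And>x. x \<in> free_vars (translate h \<iota> \<chi> :: ('s, 'f, 'r) fo_form) \<Longrightarrow> \<alpha> x \<in> univ (M v) (fst x)) \<Longrightarrow>
        sat (M v) \<alpha> (translate h \<iota> \<chi>) \<longleftrightarrow> sat (M v) \<alpha> \<psi>"
      using assms(8) formula_translate[OF assms(5) \<chi>(1)] unfolding uniform_qe_def by metis
    have "sat (M v) (\<lambda>(_, i). Inl (x i v)) \<psi> \<longleftrightarrow>
        sat (ring_structure (completion v)) (\<lambda>(_, i). x i v) \<chi>"
      if x: "x \<in> tuples finite_adeles m" and v: "v \<in> finite_places" for x v
    proof -
      have component: "x i v \<in> carrier (completion v)" if "i < m" for i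
        using A_component[OF _ v] tuples_component[OF x that] by (simp add: A)
      have "univ (M v) h = Inl ` carrier (completion v)"
        using assms(6)[OF v] by (simp add: expands_ring_def)
      then have "sat (M v) (\<lambda>(_, i). Inl (x i v)) \<psi> \<longleftrightarrow>
          sat (M v) (\<lambda>(_, i). Inl (x i v)) (translate h \<iota> \<chi>)"
        using vars component by (intro \<psi>(4)[OF v, symmetric]) auto
      also have "\<dots> \<longleftrightarrow> sat (ring_structure (completion v)) (\<lambda>(_, i). x i v) \<chi>"
        using \<chi>(2) component by (intro sat_translate[OF assms(6)[OF v] ring[OF v] \<chi>(1)]) auto
      finally show ?thesis .
    qed
    then have "\<forall>x\<in>tuples finite_adeles m. boolean_value finite_places M \<psi> x =
         {v\<in>finite_places. sat (ring_structure (completion v)) (\<lambda>(_, i). x i v) \<chi>}"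
      by (auto simp: boolean_value_def)
    then show ?thesis
      using \<psi>(1,2,3) vars by blast
  qed
  \<comment> \<open>With one sort, all quantifiers range over \<open>\<sigma>\<close>, so a formula
    free of these has none at all.\<close>
  have "quantifier_free \<psi>" if "sorts L = {\<sigma>}" "formula L \<psi>" "quantifier_free_in \<sigma> \<psi>" for \<psi> :: "('s, 'f, 'r) fo_form"
    using quantified_sorts_subset[OF that(2)] that(1,3)
    by (auto simp: quantifier_free_def quantifier_free_in_def)
  then have "sorts L = {\<sigma>} \<Longrightarrow> X \<in> boolean_combinations (tuples finite_adeles m)
      (type_I_sets L h M m quantifier_free \<union> type_II_sets L h M m quantifier_free)"
    using translation by (intro ring_definable_boolean_combination[OF assms(1,4)]) meson
  moreover have "X \<in> boolean_combinations (tuples finite_adeles m)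
      (type_I_sets L h M m (quantifier_free_in \<sigma>) \<union> type_II_sets L h M m (quantifier_free_in \<sigma>))"
    by (rule ring_definable_boolean_combination[OF assms(1,4) translation])
  ultimately show ?thesis
    by blast
qed

end
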